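(* Let $U:\mathbb{R}^d\to\mathbb{R}$ be a continuously differentiable function with $\nabla U(0)=0$ and suppose there are constants $0<m\le L$ such that $$\frac m2|x-y|^2\le U(y)-U(x)-\langle\nabla U(x),y-x\rangle\le\frac L2|x-y|^2,\qquad x,y\in\mathbb{R}^d .$$ Let $K\ge1$ be an integer. Then there exists a constant $\eta_0\in(0,1)$ depending only on $m$ and $L$ such that, for every $\eta\in(0,\eta_0)$, the PRLMC Markov chain $(\tilde X_n)_{n\ge0}$ with step size $\eta$ has a unique stationary distribution $\pi_\eta$, and it satisfies $$\pi_\eta(|x|^2):=\int_{\mathbb{R}^d}|x|^2\,\pi_\eta(\mathrm dx)\le\frac dm\Big\{2+4\eta^2L^2(2-1/K)+L^2(1-1/K)\Big\}.$$ Furthermore, there is a constant $\delta>1$, depending on the step size $\eta$, such that for every initial state $\tilde X_0=x\in\mathbb{R}^d$, $$\sum_{n=1}^\infty\delta^n d_{\mathrm{TV}}(\mathcal L(\tilde X_n),\pi_\eta)<\infty,$$ and consequently $d_{\mathrm{TV}}(\mathcal L(\tilde X_n),\pi_\eta)=o(\delta^{-n})$ as $n\to\infty$.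
   Context: PRLMC (Poisson randomized midpoint Langevin Monte Carlo) with step size $\eta>0$ and integer parameter $K\ge1$ is the Markov chain on $\mathbb{R}^d$ $$\tilde X_{k+1}=\tilde X_k-\eta\nabla U(\tilde X_k)+\eta\sum_{i=0}^{K-1}H_{k,i}\big(\nabla U(\tilde X_k)-\nabla U(\hat X_{k,i})\big)+\sqrt{2\eta}\,\xi_{k+1},\qquad k\ge0,$$ $$\hat X_{k,i}=\tilde X_k-\frac{i\eta}{K}\nabla U(\tilde X_k)+\sqrt{\frac{2i\eta}{K}}\,\xi_{k,i},\qquad 0\le i\le K-1,$$ where $(H_{k,i})$ are i.i.d. Bernoulli random variables with parameter $1/K$, $(\xi_{k+1})$ and $(\xi_{k,i})$ are i.i.d. standard Gaussian vectors in $\mathbb{R}^d$, all these variables being independent of each other and of $\tilde X_0$. $\mathcal L(X)$ denotes the law of $X$, and $d_{\mathrm{TV}}(\mu,\nu)=\sup_{A\in\mathcal B(\mathbb{R}^d)}|\mu(A)-\nu(A)|$. *)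

theory Defs
  imports "HOL-Probability.Probability" "HOL-Library.Landau_Symbols"
begin

text \<open>
  The dimension \<open>d\<close> is a term, not a type, because the step size threshold in the theorem must be
  uniform in \<open>d\<close>, and HOL cannot quantify over types inside a formula.  A vector of
  \<open>\<real>\<^sup>d\<close> is a function in \<open>{..<d} \<rightarrow>\<^sub>E UNIV\<close>, i.e. a function on \<open>nat\<close> taking the value
  \<^term>\<open>undefined\<close> outside \<open>{..<d}\<close>; this is the carrier used by the library's product measure.
  Vector-valued expressions are therefore written coordinatewise and restricted to \<open>{..<d}\<close>.
\<close>

type_synonym rvec = "nat \<Rightarrow> real"

definition Rd :: "nat \<Rightarrow> rvec measure" where
  "Rd d = Pi\<^sub>M {..<d} (\<lambda>_. borel)"

definition zero_vec :: "nat \<Rightarrow> rvec" where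
  "zero_vec d = (\<lambda>j\<in>{..<d}. 0)"

definition inner_Rd :: "nat \<Rightarrow> rvec \<Rightarrow> rvec \<Rightarrow> real" where
  "inner_Rd d x y = (\<Sum>j<d. x j * y j)"

definition diff_Rd :: "nat \<Rightarrow> rvec \<Rightarrow> rvec \<Rightarrow> rvec" where
  "diff_Rd d x y = (\<lambda>j\<in>{..<d}. x j - y j)"

definition norm_Rd :: "nat \<Rightarrow> rvec \<Rightarrow> real" where
  "norm_Rd d x = sqrt (inner_Rd d x x)"

definition grad :: "nat \<Rightarrow> (rvec \<Rightarrow> real) \<Rightarrow> rvec \<Rightarrow> rvec" where
  "grad d U x = (\<lambda>j\<in>{..<d}. deriv (\<lambda>t. U (x(j := t))) (x j))"

text \<open>
  Continuity below refers to the product topology on \<open>nat \<Rightarrow> real\<close>, which on \<open>space (Rd d)\<close> is the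
  Euclidean topology, since all coordinates beyond \<open>d\<close> are constant there.
\<close>

definition C1_on_Rd :: "nat \<Rightarrow> (rvec \<Rightarrow> real) \<Rightarrow> bool" where
  "C1_on_Rd d U \<longleftrightarrow>
     (\<forall>j<d. (\<forall>x\<in>space (Rd d). (\<lambda>t. U (x(j := t))) differentiable at (x j)) \<and>
            continuous_on (space (Rd d)) (\<lambda>x. grad d U x j))"

definition std_gauss :: "nat \<Rightarrow> rvec measure" where
  "std_gauss d = Pi\<^sub>M {..<d} (\<lambda>_. density lborel std_normal_density)"

text \<open>
  Joint law of the variables used in one step, \<open>((H\<^sub>k\<^sub>,\<^sub>i)\<^sub>i\<^sub><\<^sub>K, \<xi>\<^sub>k\<^sub>+\<^sub>1, (\<xi>\<^sub>k\<^sub>,\<^sub>i)\<^sub>i\<^sub><\<^sub>K)\<close>; independence is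
  encoded by the product measure.
\<close>

type_synonym noise = "(nat \<Rightarrow> bool) \<times> rvec \<times> (nat \<Rightarrow> rvec)"

definition prlmc_noise :: "nat \<Rightarrow> nat \<Rightarrow> noise measure" where
  "prlmc_noise d K =
     Pi\<^sub>M {..<K} (\<lambda>_. measure_pmf (bernoulli_pmf (1 / real K))) \<Otimes>\<^sub>M
     (std_gauss d \<Otimes>\<^sub>M Pi\<^sub>M {..<K} (\<lambda>_. std_gauss d))"

definition prlmc_mid :: "nat \<Rightarrow> nat \<Rightarrow> (rvec \<Rightarrow> real) \<Rightarrow> real \<Rightarrow> nat \<Rightarrow> rvec \<Rightarrow> rvec \<Rightarrow> rvec" where
  "prlmc_mid d K U \<eta> i x z =
     (\<lambda>j\<in>{..<d}. x j - (real i * \<eta> / real K) * grad d U x j + sqrt (2 * real i * \<eta> / real K) * z j)"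

definition prlmc_step :: "nat \<Rightarrow> nat \<Rightarrow> (rvec \<Rightarrow> real) \<Rightarrow> real \<Rightarrow> rvec \<Rightarrow> noise \<Rightarrow> rvec" where
  "prlmc_step d K U \<eta> x = (\<lambda>(h, \<xi>, \<zeta>). \<lambda>j\<in>{..<d}.
     x j - \<eta> * grad d U x j
     + \<eta> * (\<Sum>i<K. of_bool (h i) * (grad d U x j - grad d U (prlmc_mid d K U \<eta> i x (\<zeta> i)) j))
     + sqrt (2 * \<eta>) * \<xi> j)"

primrec prlmc_chain ::
  "nat \<Rightarrow> nat \<Rightarrow> (rvec \<Rightarrow> real) \<Rightarrow> real \<Rightarrow> rvec \<Rightarrow> (nat \<Rightarrow> noise) \<Rightarrow> nat \<Rightarrow> rvec" where
  "prlmc_chain d K U \<eta> x \<omega> 0 = x"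
| "prlmc_chain d K U \<eta> x \<omega> (Suc k) = prlmc_step d K U \<eta> (prlmc_chain d K U \<eta> x \<omega> k) (\<omega> k)"

text \<open>
  The chain is realised on the canonical space of i.i.d. noise sequences; its law does not depend
  on the realisation.
\<close>

definition prlmc_law :: "nat \<Rightarrow> nat \<Rightarrow> (rvec \<Rightarrow> real) \<Rightarrow> real \<Rightarrow> rvec \<Rightarrow> nat \<Rightarrow> rvec measure" where
  "prlmc_law d K U \<eta> x n =
     distr (Pi\<^sub>M (UNIV :: nat set) (\<lambda>_. prlmc_noise d K)) (Rd d) (\<lambda>\<omega>. prlmc_chain d K U \<eta> x \<omega> n)"

definition prlmc_kernel :: "nat \<Rightarrow> nat \<Rightarrow> (rvec \<Rightarrow> real) \<Rightarrow> real \<Rightarrow> rvec \<Rightarrow> rvec measure" where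
  "prlmc_kernel d K U \<eta> x = distr (prlmc_noise d K) (Rd d) (prlmc_step d K U \<eta> x)"

definition prlmc_stationary :: "nat \<Rightarrow> nat \<Rightarrow> (rvec \<Rightarrow> real) \<Rightarrow> real \<Rightarrow> rvec measure \<Rightarrow> bool" where
  "prlmc_stationary d K U \<eta> \<pi> \<longleftrightarrow>
     prob_space \<pi> \<and> sets \<pi> = sets (Rd d) \<and>
     (\<forall>A\<in>sets (Rd d). emeasure \<pi> A = (\<integral>\<^sup>+ x. emeasure (prlmc_kernel d K U \<eta> x) A \<partial>\<pi>))"

definition d_TV :: "nat \<Rightarrow> rvec measure \<Rightarrow> rvec measure \<Rightarrow> real" where
  "d_TV d \<mu> \<nu> = (SUP A\<in>sets (Rd d). \<bar>measure \<mu> A - measure \<nu> A\<bar>)"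

end

theory Submission
  imports Defs
begin

text \<open>
  One step of the chain has the form \<open>x \<mapsto> G\<^sub>r x + sqrt (2 \<eta>) \<xi>\<close>, where \<open>r\<close> collects the coins and the
  Gaussians of the midpoints and \<open>\<xi>\<close> is an independent standard Gaussian vector.  Two properties of
  this random map give everything except the moment bound.

  \<^item> It contracts: driving two copies with the same noise, their expected distance shrinks at least by the
    factor \<open>\<rho> = sqrt (1 - 3/2 \<eta> m) < 1\<close> (\<open>step_contraction\<close>).  The point is that strong convexity
    acts through the gradients at the \<^emph>\<open>midpoints\<close>: the number \<open>n\<close> of activated midpoints has mean
    \<open>1\<close>, so in expectation the gradient at the current point cancels, and what is left is an average
    of midpoint gradients, each of which points inwards.  Pathwise, the squared distance after one
    step is at most a quadratic polynomial in \<open>n\<close> (\<open>drift_difference_bound\<close>), so only the first two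
    moments of \<open>n\<close> enter.
  \<^item> It smooths: because of the term \<open>sqrt (2 \<eta>) \<xi>\<close>, the probability that one step lands in a
    measurable set \<open>A\<close> is a Lipschitz function of the starting point, uniformly in \<open>A\<close>
    (\<open>kernel_smoothing\<close>).

  Since the expectation of a Lipschitz function after a contracting step is Lipschitz with a constant
  smaller by the factor \<open>\<rho>\<close>, the probability of landing in \<open>A\<close> after \<open>n + 1\<close> steps is \<open>C \<rho>\<^sup>n\<close>-Lipschitz
  in the starting point (\<open>law_Lipschitz\<close>).  Applied to the starting points \<open>x\<close> and \<open>X\<^sub>1\<close>, this bounds
  the total variation distance of the laws of \<open>X\<^sub>n\<^sub>+\<^sub>1\<close> and \<open>X\<^sub>n\<^sub>+\<^sub>2\<close> by a multiple of \<open>\<rho>\<^sup>n\<close>.  Hence the laws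
  converge exponentially fast in total variation, to a limit that does not depend on \<open>x\<close>, that is
  stationary, and that is the only stationary law (\<open>exponential_ergodicity\<close>).

  The moment bound follows from a Lyapunov inequality: comparing a step from \<open>x\<close> with a step from
  the minimiser \<open>0\<close> of \<open>U\<close>, the contraction estimate gives
  \<open>E |X\<^sub>1|\<^sup>2 \<le> (1 - 5/4 \<eta> m) |x|\<^sup>2 + 11/5 \<eta> d\<close> (\<open>second_moment_step\<close>), and passing to the limit
  \<open>\<pi>(|x|\<^sup>2) \<le> 44/25 d/m \<le> 2 d/m\<close>, which is below the asserted bound.  All these estimates hold as soon as
  \<open>100 \<eta> L\<^sup>2 \<le> m\<close>, a condition on \<open>m\<close> and \<open>L\<close> alone.
\<close>

section \<open>Setwise limits of probability measures\<close>

text \<open>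
  Completeness of the space of probability measures under total variation, in the form of a
  criterion on increments.  Countable additivity of the limit is continuity at \<open>\<emptyset>\<close>, which survives
  because the convergence is uniform over measurable sets.
\<close>

lemma setwise_limit_of_probability_measures:
  fixes \<mu> :: "nat \<Rightarrow> 'a measure" and e :: "nat \<Rightarrow> real"
  assumes prob: "\<And>n. prob_space (\<mu> n)" and sets: "\<And>n. sets (\<mu> n) = sets S"
    and step: "\<And>n A. A \<in> sets S \<Longrightarrow> \<bar>measure (\<mu> (Suc n)) A - measure (\<mu> n) A\<bar> \<le> e n"
    and e: "summable e"
  obtains \<pi> where "prob_space \<pi>" "sets \<pi> = sets S"
    "\<And>n A. A \<in> sets S \<Longrightarrow> \<bar>measure (\<mu> n) A - measure \<pi> A\<bar> \<le> (\<Sum>k. e (k + n))"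
proof -
  define p where "p A = lim (\<lambda>n. measure (\<mu> n) A)" for A
  have sum_shift: "summable (\<lambda>k. e (k + n))" for n
    using e by (rule summable_ignore_initial_segment)
  have diff_summable: "summable (\<lambda>k. \<bar>measure (\<mu> (Suc (k + n))) A - measure (\<mu> (k + n)) A\<bar>)"
    if "A \<in> sets S" for A n
    by (rule summable_comparison_test'[OF sum_shift[of n], of 0]) (simp add: step[OF that])
  have lim: "(\<lambda>n. measure (\<mu> n) A) \<longlonglongrightarrow> p A" if A: "A \<in> sets S" for A
  proof -
    have "summable (\<lambda>k. measure (\<mu> (Suc k)) A - measure (\<mu> k) A)"
      by (rule summable_rabs_cancel) (use diff_summable[OF A, of 0] in simp)
    then obtain l where "(\<lambda>n. \<Sum>k<n. measure (\<mu> (Suc k)) A - measure (\<mu> k) A) \<longlonglongrightarrow> l"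
      unfolding summable_def sums_def by blast
    then have "(\<lambda>n. measure (\<mu> n) A - measure (\<mu> 0) A) \<longlonglongrightarrow> l"
      by (simp only: sum_lessThan_telescope[of "\<lambda>k. measure (\<mu> k) A"])
    from tendsto_add[OF this tendsto_const[of "measure (\<mu> 0) A"]]
    have "convergent (\<lambda>n. measure (\<mu> n) A)"
      by (auto simp: convergent_def)
    then show ?thesis
      by (simp add: p_def convergent_LIMSEQ_iff)
  qed
  have bound: "\<bar>measure (\<mu> n) A - p A\<bar> \<le> (\<Sum>k. e (k + n))" if A: "A \<in> sets S" for A n
  proof -
    have "(\<lambda>k. measure (\<mu> (Suc k + n)) A - measure (\<mu> (k + n)) A) sums
        (p A - measure (\<mu> (0 + n)) A)"
      by (rule telescope_sums) (rule LIMSEQ_ignore_initial_segment[OF lim[OF A]])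
    then have "\<bar>measure (\<mu> n) A - p A\<bar>
        = \<bar>\<Sum>k. measure (\<mu> (Suc (k + n))) A - measure (\<mu> (k + n)) A\<bar>"
      by (simp add: sums_iff abs_minus_commute)
    also have "\<dots> \<le> (\<Sum>k. \<bar>measure (\<mu> (Suc (k + n))) A - measure (\<mu> (k + n)) A\<bar>)"
      using diff_summable[OF A] by (rule summable_rabs)
    also have "\<dots> \<le> (\<Sum>k. e (k + n))"
      using diff_summable[OF A] sum_shift by (intro suminf_le) (auto intro: step[OF A])
    finally show ?thesis .
  qed
  have tail: "(\<lambda>n. \<Sum>k. e (k + n)) \<longlonglongrightarrow> 0"
    using e by (rule suminf_exist_split2)
  have p_nonneg: "0 \<le> p A" if "A \<in> sets S" for A
    by (rule LIMSEQ_le_const[OF lim[OF that]]) auto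
  have p_add: "p (A \<union> B) = p A + p B" if "A \<in> sets S" "B \<in> sets S" "A \<inter> B = {}" for A B
  proof -
    have "measure (\<mu> n) (A \<union> B) = measure (\<mu> n) A + measure (\<mu> n) B" for n
      by (intro finite_measure.finite_measure_Union)
         (use that prob sets in \<open>auto simp: prob_space_def\<close>)
    then have "(\<lambda>n. measure (\<mu> n) (A \<union> B)) \<longlonglongrightarrow> p A + p B"
      using tendsto_add[OF lim lim, OF that(1,2)] by simp
    then show ?thesis
      using lim[of "A \<union> B"] that by (auto intro: LIMSEQ_unique)
  qed
  have p_empty: "p {} = 0"
    using lim[of "{}"] by (simp add: LIMSEQ_const_iff)
  have space: "space (\<mu> n) = space S" for n
    using sets by (rule sets_eq_imp_space_eq)
  have p_space: "p (space S) = 1"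
  proof -
    have "measure (\<mu> n) (space S) = 1" for n
      using prob_space.prob_space[OF prob[of n]] by (simp add: space)
    then show ?thesis using lim[of "space S"] by (simp add: LIMSEQ_const_iff)
  qed
  have pos: "positive (sets S) (\<lambda>A. ennreal (p A))"
    by (simp add: positive_def p_empty)
  have ca: "countably_additive (sets S) (\<lambda>A. ennreal (p A))"
  proof (rule sets.empty_continuous_imp_countably_additive[OF pos])
    show "additive (sets S) (\<lambda>A. ennreal (p A))"
      by (auto simp: additive_def p_add p_nonneg ennreal_plus simp del: ennreal_plus
          intro!: ennreal_plus)
    show "\<forall>A\<in>sets S. ennreal (p A) \<noteq> \<infinity>" by simp
    fix A :: "nat \<Rightarrow> 'a set"
    assume A: "range A \<subseteq> sets S" "decseq A" "(\<Inter>i. A i) = {}"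
    have "(\<lambda>i. p (A i)) \<longlonglongrightarrow> 0"
    proof (rule LIMSEQ_I)
      fix r :: real assume "0 < r"
      then obtain n where n: "\<bar>\<Sum>k. e (k + n)\<bar> < r / 2"
        using LIMSEQ_D[OF tail, of "r / 2"] by auto
      interpret prob_space "\<mu> n" by (rule prob)
      have "(\<lambda>i. measure (\<mu> n) (A i)) \<longlonglongrightarrow> measure (\<mu> n) (\<Inter>i. A i)"
        using A sets by (intro finite_Lim_measure_decseq) auto
      then obtain N where N: "\<And>i. N \<le> i \<Longrightarrow> \<bar>measure (\<mu> n) (A i)\<bar> < r / 2"
        using LIMSEQ_D[of "\<lambda>i. measure (\<mu> n) (A i)" 0 "r / 2"] A(3) \<open>0 < r\<close> by auto
      have "norm (p (A i) - 0) < r" if "N \<le> i" for i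
      proof -
        have "\<bar>measure (\<mu> n) (A i) - p (A i)\<bar> \<le> (\<Sum>k. e (k + n))"
          by (rule bound) (use A(1) in auto)
        then show ?thesis using N[OF that] n unfolding real_norm_def by linarith
      qed
      then show "\<exists>N. \<forall>i\<ge>N. norm (p (A i) - 0) < r" by blast
    qed
    then show "(\<lambda>i. ennreal (p (A i))) \<longlonglongrightarrow> 0"
      using tendsto_ennrealI by fastforce
  qed
  define \<pi> where "\<pi> = measure_of (space S) (sets S) (\<lambda>A. ennreal (p A))"
  have sets_\<pi>: "sets \<pi> = sets S"
    by (simp add: \<pi>_def)
  have em: "emeasure \<pi> A = ennreal (p A)" if "A \<in> sets S" for A
    unfolding \<pi>_def using sets.sigma_algebra_axioms pos ca that by (rule emeasure_measure_of_sigma)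
  have "prob_space \<pi>"
    by (rule prob_spaceI) (simp add: sets_eq_imp_space_eq[OF sets_\<pi>] em p_space)
  moreover have "measure \<pi> A = p A" if "A \<in> sets S" for A
    using em[OF that] p_nonneg[OF that] by (simp add: measure_def)
  ultimately show thesis
    using sets_\<pi> bound by (intro that[of \<pi>]) auto
qed

text \<open>
  Integrals of simple functions converge under setwise convergence, and \<open>f\<close> is a supremum of simple
  functions.  This single inequality yields both the stationarity of the limit and its second
  moment.
\<close>

lemma setwise_limit_Fatou:
  assumes prob: "\<And>n. finite_measure (\<mu> n)" and fin: "finite_measure \<pi>"
    and sets: "\<And>n. sets (\<mu> n) = sets \<pi>"
    and lim: "\<And>A. A \<in> sets \<pi> \<Longrightarrow> (\<lambda>n. measure (\<mu> n) A) \<longlonglongrightarrow> measure \<pi> A"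
  shows "(\<integral>\<^sup>+x. f x \<partial>\<pi>) \<le> liminf (\<lambda>n. \<integral>\<^sup>+x. f x \<partial>\<mu> n)"
  unfolding nn_integral_def_finite[of \<pi>]
proof (rule SUP_least, clarify)
  fix g assume g: "simple_function \<pi> g" "g \<le> f" "\<forall>x. g x < top"
  have space: "space (\<mu> n) = space \<pi>" for n
    using sets by (rule sets_eq_imp_space_eq)
  have g': "simple_function (\<mu> n) g" for n
    using g(1) by (simp add: simple_function_def space sets)
  have "(\<lambda>n. integral\<^sup>S (\<mu> n) g) \<longlonglongrightarrow> integral\<^sup>S \<pi> g"
    unfolding simple_integral_def space
  proof (intro tendsto_sum ennreal_tendsto_cmult)
    fix y assume "y \<in> g ` space \<pi>"
    then show "y < top" using g(3) by auto
    have "g -` {y} \<inter> space \<pi> \<in> sets \<pi>"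
      using g(1) by (rule simple_functionD)
    then show "(\<lambda>n. emeasure (\<mu> n) (g -` {y} \<inter> space \<pi>)) \<longlonglongrightarrow> emeasure \<pi> (g -` {y} \<inter> space \<pi>)"
      using lim by (simp add: finite_measure.emeasure_eq_measure prob fin)
  qed
  then have "integral\<^sup>S \<pi> g = liminf (\<lambda>n. integral\<^sup>S (\<mu> n) g)"
    by (simp add: lim_imp_Liminf)
  also have "\<dots> \<le> liminf (\<lambda>n. \<integral>\<^sup>+x. f x \<partial>\<mu> n)"
    by (intro Liminf_mono always_eventually allI)
      (use g(2) g' in \<open>auto simp: nn_integral_eq_simple_integral[symmetric] le_fun_def
          intro!: nn_integral_mono\<close>)
  finally show "integral\<^sup>S \<pi> g \<le> liminf (\<lambda>n. \<integral>\<^sup>+x. f x \<partial>\<mu> n)" .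
qed

section \<open>Iterating a random map\<close>

primrec orbit :: "('s \<Rightarrow> 'n \<Rightarrow> 's) \<Rightarrow> 's \<Rightarrow> (nat \<Rightarrow> 'n) \<Rightarrow> nat \<Rightarrow> 's" where
  "orbit F x \<omega> 0 = x"
| "orbit F x \<omega> (Suc n) = F (orbit F x \<omega> n) (\<omega> n)"

text \<open>
  Splitting off the first noise variable, instead of the last, is what permits an induction in which
  the starting point varies.
\<close>

lemma orbit_case_nat: "orbit F x (case_nat s \<omega>) (Suc n) = orbit F (F x s) \<omega> n"
  by (induction n) auto

locale random_iteration = prob_space M for M :: "'n measure" +
  fixes S :: "'s measure" and F :: "'s \<Rightarrow> 'n \<Rightarrow> 's"
  assumes measurable_step_pair: "(\<lambda>p. F (fst p) (snd p)) \<in> S \<Otimes>\<^sub>M M \<rightarrow>\<^sub>M S"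
begin

sublocale noise: sequence_space M
  by unfold_locales

definition law :: "'s \<Rightarrow> nat \<Rightarrow> 's measure" where
  "law x n = distr noise.S S (\<lambda>\<omega>. orbit F x \<omega> n)"

definition kernel :: "'s \<Rightarrow> 's measure" where
  "kernel x = distr M S (F x)"

definition stationary :: "'s measure \<Rightarrow> bool" where
  "stationary \<nu> \<longleftrightarrow> prob_space \<nu> \<and> sets \<nu> = sets S \<and>
     (\<forall>A\<in>sets S. emeasure \<nu> A = (\<integral>\<^sup>+x. emeasure (kernel x) A \<partial>\<nu>))"

lemma measurable_step [measurable (raw)]:
  "f \<in> N \<rightarrow>\<^sub>M S \<Longrightarrow> g \<in> N \<rightarrow>\<^sub>M M \<Longrightarrow> (\<lambda>z. F (f z) (g z)) \<in> N \<rightarrow>\<^sub>M S"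
  using measurable_compose[OF measurable_Pair measurable_step_pair] by simp

lemma measurable_orbit [measurable (raw)]:
  assumes [measurable]: "f \<in> N \<rightarrow>\<^sub>M S" "g \<in> N \<rightarrow>\<^sub>M noise.S"
  shows "(\<lambda>z. orbit F (f z) (g z) n) \<in> N \<rightarrow>\<^sub>M S"
  by (induction n) simp_all

lemma sets_law [simp, measurable_cong]: "sets (law x n) = sets S"
  by (simp add: law_def)

lemma space_law [simp]: "space (law x n) = space S"
  by (simp add: law_def)

lemma sets_kernel [simp, measurable_cong]: "sets (kernel x) = sets S"
  by (simp add: kernel_def)

lemma prob_space_law: "x \<in> space S \<Longrightarrow> prob_space (law x n)"
  unfolding law_def by (rule noise.P.prob_space_distr) measurable

lemma step_in_space: "x \<in> space S \<Longrightarrow> s \<in> space M \<Longrightarrow> F x s \<in> space S"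
  using measurable_space[OF measurable_step_pair, of "(x, s)"] by (simp add: space_pair_measure)

lemma nn_integral_law:
  assumes "x \<in> space S" and [measurable]: "f \<in> borel_measurable S"
  shows "(\<integral>\<^sup>+y. f y \<partial>law x n) = (\<integral>\<^sup>+\<omega>. f (orbit F x \<omega> n) \<partial>noise.S)"
  unfolding law_def using assms by (subst nn_integral_distr) auto

lemma nn_integral_law_0:
  assumes "x \<in> space S" "f \<in> borel_measurable S"
  shows "(\<integral>\<^sup>+y. f y \<partial>law x 0) = f x"
  using assms by (simp add: nn_integral_law noise.P.emeasure_space_1)

lemma nn_integral_kernel:
  assumes "x \<in> space S" "f \<in> borel_measurable S"
  shows "(\<integral>\<^sup>+y. f y \<partial>kernel x) = (\<integral>\<^sup>+s. f (F x s) \<partial>M)"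
  unfolding kernel_def using assms by (subst nn_integral_distr) auto

lemma emeasure_kernel:
  assumes "x \<in> space S" "A \<in> sets S"
  shows "emeasure (kernel x) A = (\<integral>\<^sup>+s. indicator A (F x s) \<partial>M)"
  using nn_integral_kernel[OF assms(1), of "indicator A"] assms by simp

lemma measurable_nn_integral_law [measurable]:
  assumes [measurable]: "f \<in> borel_measurable S"
  shows "(\<lambda>x. \<integral>\<^sup>+y. f y \<partial>law x n) \<in> borel_measurable S"
  by (subst measurable_cong[OF nn_integral_law])
     (auto intro!: noise.P.borel_measurable_nn_integral)

lemma measurable_emeasure_law [measurable]:
  assumes [measurable]: "A \<in> sets S"
  shows "(\<lambda>x. emeasure (law x n) A) \<in> borel_measurable S"
  using measurable_nn_integral_law[of "indicator A" n] by simp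

lemma measurable_measure_law [measurable]:
  assumes [measurable]: "A \<in> sets S"
  shows "(\<lambda>x. measure (law x n) A) \<in> borel_measurable S"
  unfolding measure_def by measurable

lemma measurable_emeasure_kernel [measurable]:
  assumes [measurable]: "A \<in> sets S"
  shows "(\<lambda>x. emeasure (kernel x) A) \<in> borel_measurable S"
  by (subst measurable_cong[OF emeasure_kernel]) auto

text \<open>
  The Markov property at time \<open>1\<close>: an i.i.d. sequence is its first entry followed by an independent
  copy of the sequence.
\<close>

lemma nn_integral_law_Suc:
  assumes x: "x \<in> space S" and f [measurable]: "f \<in> borel_measurable S"
  shows "(\<integral>\<^sup>+y. f y \<partial>law x (Suc n)) = (\<integral>\<^sup>+s. \<integral>\<^sup>+y. f y \<partial>law (F x s) n \<partial>M)"
proof -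
  have [measurable]: "x \<in> space S" by fact
  have "(\<integral>\<^sup>+y. f y \<partial>law x (Suc n)) = (\<integral>\<^sup>+\<omega>. f (orbit F x \<omega> (Suc n)) \<partial>noise.S)"
    using assms by (rule nn_integral_law)
  also have "\<dots> = (\<integral>\<^sup>+\<omega>. f (orbit F x \<omega> (Suc n))
      \<partial>distr (M \<Otimes>\<^sub>M noise.S) noise.S (\<lambda>(s, \<omega>). case_nat s \<omega>))"
    by (simp only: noise.PiM_iter)
  also have "\<dots> = (\<integral>\<^sup>+p. f (orbit F x (case_nat (fst p) (snd p)) (Suc n)) \<partial>(M \<Otimes>\<^sub>M noise.S))"
    by (subst nn_integral_distr) (auto simp: case_prod_beta)
  also have "\<dots> = (\<integral>\<^sup>+s. \<integral>\<^sup>+\<omega>. f (orbit F (F x s) \<omega> n) \<partial>noise.S \<partial>M)"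
    unfolding orbit_case_nat by (subst noise.P.nn_integral_fst[symmetric]) auto
  also have "\<dots> = (\<integral>\<^sup>+s. \<integral>\<^sup>+y. f y \<partial>law (F x s) n \<partial>M)"
    by (intro nn_integral_cong) (simp add: nn_integral_law step_in_space x)
  finally show ?thesis .
qed

text \<open>
  The Markov property at time \<open>n\<close>.  Lyapunov inequalities and the stationarity of a limit concern
  the last step, which is therefore needed in addition to the first one.
\<close>

lemma nn_integral_law_Suc':
  assumes x: "x \<in> space S" and f [measurable]: "f \<in> borel_measurable S"
  shows "(\<integral>\<^sup>+y. f y \<partial>law x (Suc n)) = (\<integral>\<^sup>+y. \<integral>\<^sup>+s. f (F y s) \<partial>M \<partial>law x n)"
  using x
proof (induction n arbitrary: x)
  case 0
  have "(\<integral>\<^sup>+y. f y \<partial>law x (Suc 0)) = (\<integral>\<^sup>+s. f (F x s) \<partial>M)"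
    using 0 by (simp add: nn_integral_law_Suc nn_integral_law_0 step_in_space cong: nn_integral_cong)
  then show ?case using 0 by (subst nn_integral_law_0) auto
next
  case (Suc n)
  have "(\<integral>\<^sup>+y. f y \<partial>law x (Suc (Suc n))) = (\<integral>\<^sup>+s. \<integral>\<^sup>+y. f y \<partial>law (F x s) (Suc n) \<partial>M)"
    using Suc.prems f by (rule nn_integral_law_Suc)
  also have "\<dots> = (\<integral>\<^sup>+s. \<integral>\<^sup>+y. \<integral>\<^sup>+s'. f (F y s') \<partial>M \<partial>law (F x s) n \<partial>M)"
    by (intro nn_integral_cong Suc.IH step_in_space Suc.prems)
  also have "\<dots> = (\<integral>\<^sup>+y. \<integral>\<^sup>+s. f (F y s) \<partial>M \<partial>law x (Suc n))"
    by (rule nn_integral_law_Suc[symmetric, OF Suc.prems]) measurable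
  finally show ?case .
qed

lemma emeasure_law_Suc:
  assumes "x \<in> space S" "A \<in> sets S"
  shows "emeasure (law x (Suc n)) A = (\<integral>\<^sup>+s. emeasure (law (F x s) n) A \<partial>M)"
  using nn_integral_law_Suc[OF assms(1), of "indicator A"] assms by simp

lemma emeasure_law_Suc':
  assumes "x \<in> space S" "A \<in> sets S"
  shows "emeasure (law x (Suc n)) A = (\<integral>\<^sup>+y. emeasure (kernel y) A \<partial>law x n)"
proof -
  have "emeasure (law x (Suc n)) A = (\<integral>\<^sup>+y. \<integral>\<^sup>+s. indicator A (F y s) \<partial>M \<partial>law x n)"
    using nn_integral_law_Suc'[OF assms(1), of "indicator A"] assms by simp
  also have "\<dots> = (\<integral>\<^sup>+y. emeasure (kernel y) A \<partial>law x n)"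
    by (intro nn_integral_cong) (simp add: emeasure_kernel assms)
  finally show ?thesis .
qed

lemma law_1:
  assumes x: "x \<in> space S"
  shows "law x (Suc 0) = kernel x"
proof (rule measure_eqI)
  fix A assume "A \<in> sets (law x (Suc 0))"
  then have A: "A \<in> sets S" by simp
  then show "emeasure (law x (Suc 0)) A = emeasure (kernel x) A"
    using nn_integral_law_0[OF x, of "\<lambda>y. emeasure (kernel y) A"]
    by (simp add: emeasure_law_Suc'[OF x])
qed simp

lemma integrable_measure_law:
  assumes x: "x \<in> space S" and [measurable]: "A \<in> sets S"
  shows "integrable M (\<lambda>s. measure (law (F x s) n) A)"
proof (rule integrable_const_bound[of _ 1])
  show "AE s in M. norm (measure (law (F x s) n) A) \<le> 1"
    using x by (auto intro!: AE_I2 prob_space.prob_le_1 prob_space_law step_in_space)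
qed (use x in measurable)

lemma measure_law_Suc:
  assumes x: "x \<in> space S" and A [measurable]: "A \<in> sets S"
  shows "measure (law x (Suc n)) A = (\<integral>s. measure (law (F x s) n) A \<partial>M)"
proof -
  interpret L: prob_space "law x (Suc n)" using x by (rule prob_space_law)
  have "ennreal (measure (law x (Suc n)) A) = (\<integral>\<^sup>+s. ennreal (measure (law (F x s) n) A) \<partial>M)"
    unfolding L.emeasure_eq_measure[symmetric] emeasure_law_Suc[OF assms]
    by (intro nn_integral_cong finite_measure.emeasure_eq_measure prob_space.finite_measure
        prob_space_law step_in_space x)
  also have "\<dots> = ennreal (\<integral>s. measure (law (F x s) n) A \<partial>M)"
    using integrable_measure_law[OF assms] by (intro nn_integral_eq_integral) auto
  finally show ?thesis by (simp add: ennreal_inj)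
qed

lemma drift_bound_law:
  fixes a b v :: real
  assumes V [measurable]: "V \<in> borel_measurable S" and a: "0 \<le> a" "a < 1" and b: "0 \<le> b"
    and drift: "\<And>x. x \<in> space S \<Longrightarrow> (\<integral>\<^sup>+s. V (F x s) \<partial>M) \<le> ennreal a * V x + ennreal b"
    and x: "x \<in> space S" and v: "V x = ennreal v" "0 \<le> v"
  shows "(\<integral>\<^sup>+y. V y \<partial>law x n) \<le> ennreal (a ^ n * v + b / (1 - a))"
proof (induction n)
  case 0
  have "v \<le> v + b / (1 - a)" using a b by simp
  then show ?case by (simp add: nn_integral_law_0 x v ennreal_leI)
next
  case (Suc n)
  interpret L: prob_space "law x n" using x by (rule prob_space_law)
  have "(\<integral>\<^sup>+y. V y \<partial>law x (Suc n)) \<le> (\<integral>\<^sup>+y. ennreal a * V y + ennreal b \<partial>law x n)"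
    unfolding nn_integral_law_Suc'[OF x V] by (intro nn_integral_mono drift) simp
  also have "\<dots> = ennreal a * (\<integral>\<^sup>+y. V y \<partial>law x n) + ennreal b"
    using L.emeasure_space_1 by (simp add: nn_integral_add nn_integral_cmult)
  also have "\<dots> \<le> ennreal a * ennreal (a ^ n * v + b / (1 - a)) + ennreal b"
    by (intro add_right_mono mult_left_mono Suc.IH) simp
  also have "\<dots> = ennreal (a * (a ^ n * v + b / (1 - a)) + b)"
    using a b v by (simp add: ennreal_mult ennreal_plus)
  also have "a * (a ^ n * v + b / (1 - a)) + b = a ^ Suc n * v + b / (1 - a)"
    using a by (simp add: field_simps)
  finally show ?case .
qed

text \<open>
  A stationary law is invariant as an image measure under the random map, hence for all integrands
  and not only for indicators.
\<close>

lemma stationary_nn_integral: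
  assumes \<nu>: "stationary \<nu>" and f [measurable]: "f \<in> borel_measurable S"
  shows "(\<integral>\<^sup>+y. \<integral>\<^sup>+s. f (F y s) \<partial>M \<partial>\<nu>) = (\<integral>\<^sup>+y. f y \<partial>\<nu>)"
proof -
  have [measurable_cong, simp]: "sets \<nu> = sets S" and "prob_space \<nu>"
    using \<nu> by (auto simp: stationary_def)
  then interpret \<nu>: prob_space \<nu> by simp
  have space_\<nu>: "space \<nu> = space S" by (rule sets_eq_imp_space_eq) simp
  have "\<nu> = distr (\<nu> \<Otimes>\<^sub>M M) S (\<lambda>p. F (fst p) (snd p))"
  proof (rule measure_eqI)
    fix A assume "A \<in> sets \<nu>"
    then have A [measurable]: "A \<in> sets S" by simp
    have "emeasure \<nu> A = (\<integral>\<^sup>+y. \<integral>\<^sup>+s. indicator A (F y s) \<partial>M \<partial>\<nu>)"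
    proof -
      have "emeasure \<nu> A = (\<integral>\<^sup>+y. emeasure (kernel y) A \<partial>\<nu>)"
        using \<nu> A by (simp add: stationary_def)
      also have "\<dots> = (\<integral>\<^sup>+y. \<integral>\<^sup>+s. indicator A (F y s) \<partial>M \<partial>\<nu>)"
        by (intro nn_integral_cong emeasure_kernel) (simp_all add: space_\<nu>)
      finally show ?thesis .
    qed
    also have "\<dots> = (\<integral>\<^sup>+p. indicator A (F (fst p) (snd p)) \<partial>(\<nu> \<Otimes>\<^sub>M M))"
      by (subst nn_integral_fst[symmetric]) auto
    also have "\<dots> = (\<integral>\<^sup>+p. indicator A p \<partial>distr (\<nu> \<Otimes>\<^sub>M M) S (\<lambda>p. F (fst p) (snd p)))"
      by (subst nn_integral_distr) auto
    finally show "emeasure \<nu> A = emeasure (distr (\<nu> \<Otimes>\<^sub>M M) S (\<lambda>p. F (fst p) (snd p))) A"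
      by simp
  qed simp
  then have "(\<integral>\<^sup>+y. f y \<partial>\<nu>) = (\<integral>\<^sup>+y. f y \<partial>distr (\<nu> \<Otimes>\<^sub>M M) S (\<lambda>p. F (fst p) (snd p)))"
    by simp
  also have "\<dots> = (\<integral>\<^sup>+p. f (F (fst p) (snd p)) \<partial>(\<nu> \<Otimes>\<^sub>M M))"
    by (subst nn_integral_distr) auto
  also have "\<dots> = (\<integral>\<^sup>+y. \<integral>\<^sup>+s. f (F y s) \<partial>M \<partial>\<nu>)"
    by (subst nn_integral_fst[symmetric]) auto
  finally show ?thesis by simp
qed

lemma stationary_law:
  assumes \<nu>: "stationary \<nu>" and A [measurable]: "A \<in> sets S"
  shows "(\<integral>\<^sup>+y. emeasure (law y n) A \<partial>\<nu>) = emeasure \<nu> A"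
proof (induction n)
  have space_\<nu>: "space \<nu> = space S"
    by (rule sets_eq_imp_space_eq) (use \<nu> in \<open>simp add: stationary_def\<close>)
  {
    case 0
    have "emeasure (law y 0) A = indicator A y" if "y \<in> space S" for y
      using nn_integral_law_0[OF that, of "indicator A"] by simp
    then have "(\<integral>\<^sup>+y. emeasure (law y 0) A \<partial>\<nu>) = (\<integral>\<^sup>+y. indicator A y \<partial>\<nu>)"
      by (intro nn_integral_cong) (simp add: space_\<nu>)
    then show ?case using \<nu> by (simp add: stationary_def)
  next
    case (Suc n)
    have "(\<integral>\<^sup>+y. emeasure (law y (Suc n)) A \<partial>\<nu>)
        = (\<integral>\<^sup>+y. \<integral>\<^sup>+s. emeasure (law (F y s) n) A \<partial>M \<partial>\<nu>)"
      by (intro nn_integral_cong emeasure_law_Suc) (auto simp: space_\<nu>)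
    also have "\<dots> = emeasure \<nu> A"
      using stationary_nn_integral[OF \<nu>, of "\<lambda>y. emeasure (law y n) A"] by (simp add: Suc.IH)
    finally show ?case .
  }
qed

end

section \<open>Ergodicity of contracting and smoothing random maps\<close>

text \<open>
  Smoothing turns the bounded function \<open>indicator A\<close> into a Lipschitz function of the starting point
  with respect to \<open>d\<close>; contraction then improves the Lipschitz constant in every further step.
\<close>

locale contractive_random_iteration = random_iteration M S F
  for M :: "'n measure" and S :: "'s measure" and F :: "'s \<Rightarrow> 'n \<Rightarrow> 's" +
  fixes d :: "'s \<Rightarrow> 's \<Rightarrow> real" and C \<rho> :: real
  assumes nonempty: "space S \<noteq> {}"
    and C: "0 \<le> C" and \<rho>: "0 \<le> \<rho>" "\<rho> < 1"
    and smoothing: "\<And>x y A. x \<in> space S \<Longrightarrow> y \<in> space S \<Longrightarrow> A \<in> sets S \<Longrightarrow>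
      \<bar>measure (kernel x) A - measure (kernel y) A\<bar> \<le> C * d x y"
    and integrable_dist: "\<And>x y. x \<in> space S \<Longrightarrow> y \<in> space S \<Longrightarrow> integrable M (\<lambda>s. d (F x s) (F y s))"
    and contraction: "\<And>x y. x \<in> space S \<Longrightarrow> y \<in> space S \<Longrightarrow>
      (\<integral>s. d (F x s) (F y s) \<partial>M) \<le> \<rho> * d x y"
    and integrable_displacement: "\<And>x. x \<in> space S \<Longrightarrow> integrable M (\<lambda>s. d x (F x s))"
begin

text \<open>
  The first step creates the Lipschitz bound by smoothing; every further step is a contraction and
  improves its constant by the factor \<open>\<rho>\<close>.
\<close>

lemma law_Lipschitz:
  assumes "x \<in> space S" "y \<in> space S" and A: "A \<in> sets S"
  shows "\<bar>measure (law x (Suc n)) A - measure (law y (Suc n)) A\<bar> \<le> C * \<rho> ^ n * d x y"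
  using assms(1,2)
proof (induction n arbitrary: x y)
  case 0
  then show ?case using smoothing[OF _ _ A] by (simp add: law_1)
next
  case (Suc n)
  let ?m = "\<lambda>x s. measure (law (F x s) (Suc n)) A"
  have "\<bar>measure (law x (Suc (Suc n))) A - measure (law y (Suc (Suc n))) A\<bar>
      = \<bar>\<integral>s. ?m x s - ?m y s \<partial>M\<bar>"
    using Suc.prems A by (simp add: measure_law_Suc[of _ _ "Suc n"] integrable_measure_law)
  also have "\<dots> \<le> (\<integral>s. C * \<rho> ^ n * d (F x s) (F y s) \<partial>M)"
  proof (rule integral_abs_bound[THEN order_trans], rule integral_mono)
    show "integrable M (\<lambda>s. \<bar>?m x s - ?m y s\<bar>)"
      using Suc.prems A by (auto simp: integrable_measure_law)
    show "integrable M (\<lambda>s. C * \<rho> ^ n * d (F x s) (F y s))"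
      using Suc.prems by (auto simp: integrable_dist)
    show "\<bar>?m x s - ?m y s\<bar> \<le> C * \<rho> ^ n * d (F x s) (F y s)" if "s \<in> space M" for s
      using Suc.prems that by (intro Suc.IH step_in_space)
  qed
  also have "\<dots> \<le> C * \<rho> ^ n * (\<rho> * d x y)"
    using contraction[OF Suc.prems] C \<rho> by (simp add: mult_left_mono)
  finally show ?case by (simp add: mult_ac)
qed

text \<open>
  The law at time \<open>n + 2\<close> started in \<open>x\<close> is the law at time \<open>n + 1\<close> started in the random point
  \<open>F x s\<close>, so an increment in time is a change of the starting point.
\<close>

lemma law_increment:
  assumes x: "x \<in> space S" and A: "A \<in> sets S"
  shows "\<bar>measure (law x (Suc (Suc n))) A - measure (law x (Suc n)) A\<bar>
    \<le> C * (\<integral>s. d x (F x s) \<partial>M) * \<rho> ^ n"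
proof -
  let ?m = "\<lambda>s. measure (law (F x s) (Suc n)) A"
  have "\<bar>measure (law x (Suc (Suc n))) A - measure (law x (Suc n)) A\<bar>
      = \<bar>\<integral>s. ?m s - measure (law x (Suc n)) A \<partial>M\<bar>"
    using assms by (simp add: measure_law_Suc[of _ _ "Suc n"] integrable_measure_law prob_space)
  also have "\<dots> \<le> (\<integral>s. C * \<rho> ^ n * d x (F x s) \<partial>M)"
  proof (rule integral_abs_bound[THEN order_trans], rule integral_mono)
    show "integrable M (\<lambda>s. \<bar>?m s - measure (law x (Suc n)) A\<bar>)"
      using assms by (auto simp: integrable_measure_law)
    show "integrable M (\<lambda>s. C * \<rho> ^ n * d x (F x s))"
      using x by (auto simp: integrable_displacement)
    show "\<bar>?m s - measure (law x (Suc n)) A\<bar> \<le> C * \<rho> ^ n * d x (F x s)" if "s \<in> space M" for s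
      using law_Lipschitz[OF x step_in_space[OF x that] A, of n] by (simp add: abs_minus_commute)
  qed
  finally show ?thesis by (simp add: mult_ac)
qed

text \<open>
  The constant of exponential convergence: the sum over \<open>n\<close> of the bounds in \<open>law_increment\<close>.
\<close>

definition rate :: "'s \<Rightarrow> real" where
  "rate x = C * (\<integral>s. d x (F x s) \<partial>M) / (1 - \<rho>)"

lemma common_limit:
  obtains \<pi> where "prob_space \<pi>" "sets \<pi> = sets S"
    "\<And>x n A. x \<in> space S \<Longrightarrow> A \<in> sets S \<Longrightarrow>
      \<bar>measure (law x (Suc n)) A - measure \<pi> A\<bar> \<le> rate x * \<rho> ^ n"
proof -
  have *: "\<exists>\<pi>. prob_space \<pi> \<and> sets \<pi> = sets S \<and>
      (\<forall>n. \<forall>A\<in>sets S. \<bar>measure (law x (Suc n)) A - measure \<pi> A\<bar> \<le> rate x * \<rho> ^ n)"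
    if x: "x \<in> space S" for x
  proof -
    let ?c = "C * (\<integral>s. d x (F x s) \<partial>M)"
    have geometric: "(\<lambda>k. ?c * \<rho> ^ (k + n)) sums (rate x * \<rho> ^ n)" for n
      using sums_mult[OF geometric_sums[of \<rho>], of "?c * \<rho> ^ n"] \<rho>
      by (simp add: rate_def power_add mult_ac)
    obtain \<pi> where "prob_space \<pi>" "sets \<pi> = sets S"
      "\<And>n A. A \<in> sets S \<Longrightarrow>
        \<bar>measure (law x (Suc n)) A - measure \<pi> A\<bar> \<le> (\<Sum>k. ?c * \<rho> ^ (k + n))"
    proof (rule setwise_limit_of_probability_measures[of "\<lambda>n. law x (Suc n)" S "\<lambda>n. ?c * \<rho> ^ n"])
      show "summable (\<lambda>n. ?c * \<rho> ^ n)"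
        using geometric[of 0] by (simp add: sums_iff)
    qed (use x in \<open>auto intro: prob_space_law law_increment\<close>)
    then show ?thesis
      using geometric by (auto simp: sums_iff)
  qed
  have vanish: "(\<lambda>n. c * \<rho> ^ n) \<longlonglongrightarrow> 0" for c
    using tendsto_mult_right_zero[OF LIMSEQ_power_zero[of \<rho>], of c] \<rho> by simp
  have conv: "(\<lambda>n. measure (law x (Suc n)) A) \<longlonglongrightarrow> p"
    if "\<forall>n. \<bar>measure (law x (Suc n)) A - p\<bar> \<le> c * \<rho> ^ n" for x A p c
    by (rule LIM_zero_cancel, rule Lim_null_comparison[OF _ vanish[of c]]) (use that in auto)
  obtain x0 where x0: "x0 \<in> space S" using nonempty by auto
  obtain \<pi> where \<pi>: "prob_space \<pi>" "sets \<pi> = sets S"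
    "\<And>n A. A \<in> sets S \<Longrightarrow> \<bar>measure (law x0 (Suc n)) A - measure \<pi> A\<bar> \<le> rate x0 * \<rho> ^ n"
    using *[OF x0] by blast
  show thesis
  proof (rule that[OF \<pi>(1,2)])
    fix x n A assume x: "x \<in> space S" and A: "A \<in> sets S"
    obtain \<pi>' where \<pi>': "\<forall>n. \<bar>measure (law x (Suc n)) A - measure \<pi>' A\<bar> \<le> rate x * \<rho> ^ n"
      using *[OF x] A by blast
    have "(\<lambda>n. measure (law x0 (Suc n)) A - measure (law x (Suc n)) A) \<longlonglongrightarrow> 0"
      by (rule Lim_null_comparison[OF _ vanish[of "C * d x0 x"]])
         (use law_Lipschitz[OF x0 x A] in \<open>auto simp: mult_ac\<close>)
    moreover have "(\<lambda>n. measure (law x0 (Suc n)) A - measure (law x (Suc n)) A)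
        \<longlonglongrightarrow> measure \<pi> A - measure \<pi>' A"
      using \<pi>(3)[OF A] \<pi>' by (intro tendsto_diff conv) blast+
    ultimately have "measure \<pi> A = measure \<pi>' A"
      using LIMSEQ_unique by fastforce
    then show "\<bar>measure (law x (Suc n)) A - measure \<pi> A\<bar> \<le> rate x * \<rho> ^ n"
      using \<pi>' by simp
  qed
qed

text \<open>
  The inequality \<open>\<integral> k(y, A) d\<pi> \<le> \<pi> A\<close> follows from Fatou's lemma, since the laws at times \<open>n\<close> and
  \<open>n + 1\<close> have the same limit.  Used for \<open>A\<close> and for its complement, whose two sides add up to \<open>1\<close>,
  it becomes an equality.  The last clause turns a Lyapunov function into a bound on its mean under
  \<open>\<pi>\<close>, again by Fatou's lemma.
\<close>

theorem exponential_ergodicity: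
  obtains \<pi> where "stationary \<pi>" "\<And>\<nu>. stationary \<nu> \<Longrightarrow> \<nu> = \<pi>"
    "\<And>x n A. x \<in> space S \<Longrightarrow> A \<in> sets S \<Longrightarrow>
      \<bar>measure (law x (Suc n)) A - measure \<pi> A\<bar> \<le> rate x * \<rho> ^ n"
    "\<And>V a b x. V \<in> borel_measurable S \<Longrightarrow> 0 \<le> a \<Longrightarrow> a < 1 \<Longrightarrow> 0 \<le> b \<Longrightarrow>
      (\<And>x. x \<in> space S \<Longrightarrow> (\<integral>\<^sup>+s. V (F x s) \<partial>M) \<le> ennreal a * V x + ennreal b) \<Longrightarrow>
      x \<in> space S \<Longrightarrow> V x < \<infinity> \<Longrightarrow> (\<integral>\<^sup>+y. V y \<partial>\<pi>) \<le> ennreal (b / (1 - a))"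
proof -
  obtain \<pi> where \<pi>: "prob_space \<pi>" "sets \<pi> = sets S"
    and rate: "\<And>x n A. x \<in> space S \<Longrightarrow> A \<in> sets S \<Longrightarrow>
      \<bar>measure (law x (Suc n)) A - measure \<pi> A\<bar> \<le> rate x * \<rho> ^ n"
    by (rule common_limit) blast
  interpret \<pi>: prob_space \<pi> by fact
  note \<pi>(2) [simp, measurable_cong]
  have space_\<pi>: "space \<pi> = space S"
    using \<pi>(2) by (rule sets_eq_imp_space_eq)
  have conv: "(\<lambda>n. measure (law x (Suc n)) A) \<longlonglongrightarrow> measure \<pi> A"
    if "x \<in> space S" "A \<in> sets S" for x A
  proof (rule LIM_zero_cancel, rule Lim_null_comparison)
    show "(\<lambda>n. rate x * \<rho> ^ n) \<longlonglongrightarrow> 0"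
      using tendsto_mult_right_zero[OF LIMSEQ_power_zero[of \<rho>], of "rate x"] \<rho> by simp
  qed (use rate[OF that] in auto)
  have Fatou: "(\<integral>\<^sup>+y. f y \<partial>\<pi>) \<le> liminf (\<lambda>n. \<integral>\<^sup>+y. f y \<partial>law x (Suc n))" if "x \<in> space S" for f x
    using that by (intro setwise_limit_Fatou prob_space.finite_measure prob_space_law \<pi> conv) auto
  have sub: "(\<integral>\<^sup>+y. emeasure (kernel y) A \<partial>\<pi>) \<le> emeasure \<pi> A" if A: "A \<in> sets S" for A
  proof -
    obtain x where x: "x \<in> space S" using nonempty by auto
    have "(\<lambda>n. emeasure (law x (Suc (Suc n))) A) \<longlonglongrightarrow> emeasure \<pi> A"
      using LIMSEQ_Suc[OF conv[OF x A]] x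
      by (simp add: \<pi>.emeasure_eq_measure prob_space_law
          finite_measure.emeasure_eq_measure[OF prob_space.finite_measure])
    then have "liminf (\<lambda>n. \<integral>\<^sup>+y. emeasure (kernel y) A \<partial>law x (Suc n)) = emeasure \<pi> A"
      by (simp add: emeasure_law_Suc'[OF x A, symmetric] lim_imp_Liminf)
    then show ?thesis using Fatou[OF x, of "\<lambda>y. emeasure (kernel y) A"] by simp
  qed
  have stat: "stationary \<pi>"
    unfolding stationary_def
  proof (intro conjI ballI \<pi>)
    fix A assume A [measurable]: "A \<in> sets S"
    let ?k = "\<lambda>A. \<integral>\<^sup>+y. emeasure (kernel y) A \<partial>\<pi>"
    have "?k A + ?k (space S - A) = (\<integral>\<^sup>+y. emeasure (kernel y) A + emeasure (kernel y) (space S - A) \<partial>\<pi>)"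
      by (subst nn_integral_add) auto
    also have "\<dots> = (\<integral>\<^sup>+y. 1 \<partial>\<pi>)"
    proof (rule nn_integral_cong)
      fix y assume "y \<in> space \<pi>"
      then have "prob_space (kernel y)"
        using prob_space_law[of y "Suc 0"] by (simp add: law_1 space_\<pi>)
      moreover have "space (kernel y) = space S" by (simp add: kernel_def)
      ultimately show "emeasure (kernel y) A + emeasure (kernel y) (space S - A) = 1"
        using A prob_space.emeasure_space_1[of "kernel y"] sets.sets_into_space[OF A]
        by (subst plus_emeasure) (auto simp: Un_absorb1)
    qed
    also have "\<dots> = emeasure \<pi> A + emeasure \<pi> (space S - A)"
      using A \<pi>.emeasure_space_1 sets.sets_into_space[OF A]
      by (subst plus_emeasure) (auto simp: Un_absorb1 space_\<pi>)
    finally have eq: "?k A + ?k (space S - A) = emeasure \<pi> A + emeasure \<pi> (space S - A)" .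
    \<comment> \<open>the complement cannot lose mass to compensate a gain of \<open>A\<close>, so neither inequality is strict\<close>
    have "emeasure \<pi> (space S - A) + emeasure \<pi> A \<le> emeasure \<pi> (space S - A) + ?k A"
      using eq add_left_mono[OF sub[of "space S - A"], of "?k A"] by (simp add: add.commute)
    then have "emeasure \<pi> A \<le> ?k A"
      using \<pi>.emeasure_finite by (simp add: ennreal_add_left_cancel_le)
    with sub[OF A] show "emeasure \<pi> A = ?k A" by simp
  qed
  show thesis
  proof (rule that[OF stat _ rate])
    fix \<nu> assume \<nu>: "stationary \<nu>"
    then have [simp, measurable_cong]: "sets \<nu> = sets S" by (simp add: stationary_def)
    interpret \<nu>: prob_space \<nu> using \<nu> by (simp add: stationary_def)
    have space_\<nu>: "space \<nu> = space S" by (rule sets_eq_imp_space_eq) simp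
    show "\<nu> = \<pi>"
    proof (rule measure_eqI)
      fix A assume "A \<in> sets \<nu>"
      then have A [measurable]: "A \<in> sets S" by simp
      have le1: "measure (law y n) A \<le> 1" if "y \<in> space S" for y n
        using that by (intro prob_space.prob_le_1 prob_space_law)
      have "measure \<nu> A = (\<integral>y. measure (law y (Suc n)) A \<partial>\<nu>)" for n
      proof -
        have "integrable \<nu> (\<lambda>y. measure (law y (Suc n)) A)"
          by (rule \<nu>.integrable_const_bound[of _ 1])
             (auto intro!: AE_I2 le1 simp: space_\<nu> simp del: orbit.simps)
        then have "ennreal (\<integral>y. measure (law y (Suc n)) A \<partial>\<nu>)
            = (\<integral>\<^sup>+y. ennreal (measure (law y (Suc n)) A) \<partial>\<nu>)"
          by (intro nn_integral_eq_integral[symmetric]) auto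
        also have "\<dots> = (\<integral>\<^sup>+y. emeasure (law y (Suc n)) A \<partial>\<nu>)"
          by (intro nn_integral_cong finite_measure.emeasure_eq_measure[symmetric]
              prob_space.finite_measure prob_space_law) (simp add: space_\<nu>)
        also have "\<dots> = ennreal (measure \<nu> A)"
          using stationary_law[OF \<nu> A] by (simp add: \<nu>.emeasure_eq_measure)
        finally show ?thesis by (simp add: ennreal_inj integral_nonneg_AE)
      qed
      moreover have "(\<lambda>n. \<integral>y. measure (law y (Suc n)) A \<partial>\<nu>) \<longlonglongrightarrow> (\<integral>y. measure \<pi> A \<partial>\<nu>)"
        by (rule integral_dominated_convergence[where w = "\<lambda>_. 1"])
           (auto intro!: AE_I2 conv le1 simp: space_\<nu>)
      ultimately have "(\<lambda>n. measure \<nu> A) \<longlonglongrightarrow> measure \<pi> A"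
        by (simp add: \<nu>.prob_space)
      then show "emeasure \<nu> A = emeasure \<pi> A"
        by (simp add: LIMSEQ_const_iff \<nu>.emeasure_eq_measure \<pi>.emeasure_eq_measure)
    qed simp
  next
    fix V :: "'s \<Rightarrow> ennreal" and a b :: real and x
    assume V: "V \<in> borel_measurable S" and a: "0 \<le> a" "a < 1" and b: "0 \<le> b"
      and drift: "\<And>x. x \<in> space S \<Longrightarrow> (\<integral>\<^sup>+s. V (F x s) \<partial>M) \<le> ennreal a * V x + ennreal b"
      and x: "x \<in> space S" "V x < \<infinity>"
    obtain v where v: "V x = ennreal v" "0 \<le> v"
      using x(2) by (cases "V x") auto
    have "(\<lambda>n. a ^ Suc n * v + b / (1 - a)) \<longlonglongrightarrow> 0 * v + b / (1 - a)"
      using a by (intro tendsto_intros LIMSEQ_Suc LIMSEQ_power_zero) auto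
    then have "(\<lambda>n. ennreal (a ^ Suc n * v + b / (1 - a))) \<longlonglongrightarrow> ennreal (b / (1 - a))"
      by (intro tendsto_ennrealI) simp
    then have "liminf (\<lambda>n. ennreal (a ^ Suc n * v + b / (1 - a))) = ennreal (b / (1 - a))"
      by (intro lim_imp_Liminf) auto
    moreover have "liminf (\<lambda>n. \<integral>\<^sup>+y. V y \<partial>law x (Suc n))
        \<le> liminf (\<lambda>n. ennreal (a ^ Suc n * v + b / (1 - a)))"
      by (intro Liminf_mono always_eventually allI drift_bound_law[OF V a b drift x(1) v])
    ultimately show "(\<integral>\<^sup>+y. V y \<partial>\<pi>) \<le> ennreal (b / (1 - a))"
      using Fatou[OF x(1), of V] by simp
  qed
qed

end

section \<open>Gaussian vectors\<close>

abbreviation std_normal :: "real measure" where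
  "std_normal \<equiv> density lborel std_normal_density"

lemma prob_space_std_normal: "prob_space std_normal"
  by (rule prob_space_normal_density) simp

lemma measure_std_normal:
  assumes [measurable]: "B \<in> sets borel"
  shows "measure std_normal {t. t + h \<in> B} = (\<integral>t. normal_density h 1 t * indicator B t \<partial>lborel)"
    and "integrable lborel (\<lambda>t. normal_density h 1 t * indicator B t :: real)"
proof -
  show int: "integrable lborel (\<lambda>t. normal_density h 1 t * indicator B t :: real)"
    by (rule integrable_real_mult_indicator) auto
  have "emeasure std_normal {t. t + h \<in> B}
      = (\<integral>\<^sup>+t. ennreal (std_normal_density t) * indicator {t. t + h \<in> B} t \<partial>lborel)"
    by (rule emeasure_density) measurable
  also have "\<dots> = (\<integral>\<^sup>+t. ennreal (normal_density h 1 (h + 1 * t)) * indicator B (h + 1 * t) \<partial>lborel)"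
    by (intro nn_integral_cong) (simp add: normal_density_def indicator_def add.commute)
  also have "\<dots> = (\<integral>\<^sup>+t. ennreal (normal_density h 1 t) * indicator B t \<partial>lborel)"
    using nn_integral_real_affine[of "\<lambda>t. ennreal (normal_density h 1 t) * indicator B t" 1 h] by simp
  also have "\<dots> = (\<integral>\<^sup>+t. ennreal (normal_density h 1 t * indicator B t) \<partial>lborel)"
    by (intro nn_integral_cong) (auto split: split_indicator)
  also have "\<dots> = ennreal (\<integral>t. normal_density h 1 t * indicator B t \<partial>lborel)"
    using int by (intro nn_integral_eq_integral) auto
  finally show "measure std_normal {t. t + h \<in> B} = (\<integral>t. normal_density h 1 t * indicator B t \<partial>lborel)"
    by (simp add: measure_def integral_nonneg_AE)
qed

lemma std_normal_density_le_1: "std_normal_density t \<le> 1"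
proof -
  have "1 \<le> sqrt (2 * pi)" using pi_ge_two by (simp add: real_le_rsqrt)
  then have "1 / sqrt (2 * pi) * exp (- t\<^sup>2 / 2) \<le> 1 * 1"
    by (intro mult_mono) auto
  then show ?thesis by (simp add: std_normal_density_def)
qed

text \<open>
  For \<open>h > 0\<close> the density of the standard normal law is at least its translate by \<open>h\<close> exactly on
  \<open>{..h / 2}\<close>, so this half line maximises the left hand side.  For the half line the difference is the mass of an
  interval of length \<open>h\<close>, and the density is at most \<open>1\<close>.
\<close>

lemma std_normal_shift_nonneg:
  assumes h: "0 \<le> h" and [measurable]: "B \<in> sets borel"
  shows "measure std_normal B - measure std_normal {t. t + h \<in> B} \<le> h"
proof -
  interpret prob_space std_normal by (rule prob_space_std_normal)
  let ?f = "\<lambda>t. std_normal_density t - normal_density h 1 t"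
  let ?H = "{..h / 2}"
  have split: "measure std_normal B - measure std_normal {t. t + h \<in> B}
      = (\<integral>t. ?f t * indicator B t \<partial>lborel)" "integrable lborel (\<lambda>t. ?f t * indicator B t)"
    if [measurable]: "B \<in> sets borel" for B
    using measure_std_normal[of B 0] measure_std_normal[of B h] that
    by (simp_all add: left_diff_distrib)
  have sign: "0 \<le> ?f t \<longleftrightarrow> t \<le> h / 2" if "0 < h" for t
  proof -
    have "0 \<le> ?f t \<longleftrightarrow> t\<^sup>2 \<le> (t - h)\<^sup>2"
      by (simp add: normal_density_def divide_right_mono field_simps)
    also have "\<dots> \<longleftrightarrow> 2 * t * h \<le> h * h"
      by (simp add: power2_eq_square algebra_simps)
    also have "\<dots> \<longleftrightarrow> t \<le> h / 2"
      using that by (simp add: field_simps)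
    finally show ?thesis .
  qed
  show ?thesis
  proof (cases "h = 0")
    case False
    with h have h: "0 < h" by simp
    have "measure std_normal B - measure std_normal {t. t + h \<in> B}
        = (\<integral>t. ?f t * indicator B t \<partial>lborel)"
      by (rule split(1)) simp
    also have "\<dots> \<le> (\<integral>t. ?f t * indicator ?H t \<partial>lborel)"
    proof (rule integral_mono)
      show "?f t * indicator B t \<le> ?f t * indicator ?H t" for t
        using sign[OF h, of t] by (auto simp: indicator_def)
    qed (auto intro: split(2))
    also have "\<dots> = measure std_normal ?H - measure std_normal {t. t + h \<in> ?H}"
      by (rule split(1)[symmetric]) simp
    also have "\<dots> = measure std_normal (?H - {t. t + h \<in> ?H})"
      using h by (intro finite_measure_Diff[symmetric]) auto
    also have "?H - {t. t + h \<in> ?H} = {- h / 2<..h / 2}"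
      by (auto simp: field_simps)
    also have "measure std_normal {- h / 2<..h / 2} \<le> h"
    proof -
      have "emeasure std_normal {- h / 2<..h / 2}
          = (\<integral>\<^sup>+t. ennreal (std_normal_density t) * indicator {- h / 2<..h / 2} t \<partial>lborel)"
        by (rule emeasure_density) measurable
      also have "\<dots> \<le> (\<integral>\<^sup>+t. indicator {- h / 2<..h / 2} t \<partial>lborel)"
        using std_normal_density_le_1
        by (intro nn_integral_mono) (auto split: split_indicator)
      also have "\<dots> = ennreal h" using h by simp
      finally show ?thesis using h by (simp add: emeasure_eq_measure)
    qed
    finally show ?thesis .
  qed simp
qed

text \<open>
  The two-sided bound comes from the one-sided one for \<open>B\<close> and for its complement; the sign of \<open>h\<close>
  is absorbed by exchanging \<open>B\<close> with its translate.
\<close>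

lemma std_normal_shift:
  assumes [measurable]: "B \<in> sets borel"
  shows "\<bar>measure std_normal B - measure std_normal {t. t + h \<in> B}\<bar> \<le> \<bar>h\<bar>"
proof -
  interpret prob_space std_normal by (rule prob_space_std_normal)
  have nonneg: "\<bar>measure std_normal B - measure std_normal {t. t + h \<in> B}\<bar> \<le> h"
    if h: "0 \<le> h" and B [measurable]: "B \<in> sets borel" for h B
  proof -
    have "measure std_normal (- B) = 1 - measure std_normal B"
      using prob_compl[of B] B by (simp add: Compl_eq_Diff_UNIV)
    moreover have "measure std_normal {t. t + h \<in> - B} = 1 - measure std_normal {t. t + h \<in> B}"
      using prob_compl[of "{t. t + h \<in> B}"]
      by (simp add: Compl_eq_Diff_UNIV[symmetric] Collect_neg_eq[symmetric])
    moreover have "measure std_normal (- B) - measure std_normal {t. t + h \<in> - B} \<le> h"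
      by (rule std_normal_shift_nonneg[OF h]) auto
    moreover note std_normal_shift_nonneg[OF h B]
    ultimately show ?thesis by linarith
  qed
  show ?thesis
  proof (cases "0 \<le> h")
    case True
    then show ?thesis using nonneg[of h B] by simp
  next
    case False
    have "{t. t + - h \<in> {t. t + h \<in> B}} = B" by simp
    then show ?thesis using nonneg[of "- h" "{t. t + h \<in> B}"] False by simp
  qed
qed

lemma std_normal_affine_shift:
  assumes \<sigma>: "0 < \<sigma>" and [measurable]: "B \<in> sets borel"
  shows "\<bar>measure std_normal {t. a + \<sigma> * t \<in> B} - measure std_normal {t. b + \<sigma> * t \<in> B}\<bar> \<le> \<bar>a - b\<bar> / \<sigma>"
proof -
  have "a + \<sigma> * (t + (b - a) / \<sigma>) = b + \<sigma> * t" for t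
    using \<sigma> by (simp add: field_simps)
  then have "{t. t + (b - a) / \<sigma> \<in> {t. a + \<sigma> * t \<in> B}} = {t. b + \<sigma> * t \<in> B}"
    by simp
  moreover have "\<bar>(b - a) / \<sigma>\<bar> = \<bar>a - b\<bar> / \<sigma>"
    using \<sigma> by (simp add: abs_divide abs_minus_commute)
  ultimately show ?thesis
    using std_normal_shift[of "{t. a + \<sigma> * t \<in> B}" "(b - a) / \<sigma>"] by simp
qed

lemma nn_integral_std_normal_affine_square:
  "(\<integral>\<^sup>+t. ennreal ((a + \<sigma> * t)\<^sup>2) \<partial>std_normal) = ennreal (a\<^sup>2 + \<sigma>\<^sup>2)"
proof -
  let ?g = "\<lambda>t. a\<^sup>2 * std_normal_density t + 2 * a * \<sigma> * (std_normal_density t * t)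
      + \<sigma>\<^sup>2 * (std_normal_density t * t\<^sup>2)"
  have "has_bochner_integral lborel (\<lambda>t. std_normal_density t * t ^ (2 * 1)) 1"
    using std_normal_moment_even[of 1] by (simp add: numeral_2_eq_2)
  then have m2: "has_bochner_integral lborel (\<lambda>t. std_normal_density t * t\<^sup>2) 1"
    by simp
  have m1: "has_bochner_integral lborel (\<lambda>t. std_normal_density t * t) 0"
    using normal_moment_nz_1[of 1 0] by simp
  have m0: "has_bochner_integral lborel std_normal_density 1"
    by (simp add: has_bochner_integral_iff)
  have "has_bochner_integral lborel ?g (a\<^sup>2 * 1 + 2 * a * \<sigma> * 0 + \<sigma>\<^sup>2 * 1)"
    by (intro has_bochner_integral_add has_bochner_integral_mult_right m0 m1 m2)
  moreover have "?g t = std_normal_density t * (a + \<sigma> * t)\<^sup>2" for t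
    by (simp add: power2_eq_square algebra_simps)
  ultimately have "has_bochner_integral lborel (\<lambda>t. std_normal_density t * (a + \<sigma> * t)\<^sup>2) (a\<^sup>2 + \<sigma>\<^sup>2)"
    by simp
  then have "(\<integral>\<^sup>+t. ennreal (std_normal_density t * (a + \<sigma> * t)\<^sup>2) \<partial>lborel) = ennreal (a\<^sup>2 + \<sigma>\<^sup>2)"
    by (subst nn_integral_eq_integral) (auto simp: has_bochner_integral_iff)
  then show ?thesis
    by (subst nn_integral_density) (auto simp: ennreal_mult)
qed

lemma prob_space_std_gauss: "prob_space (std_gauss d)"
  unfolding std_gauss_def by (intro prob_space_PiM prob_space_std_normal)

lemma sets_std_gauss [simp, measurable_cong]: "sets (std_gauss d) = sets (Rd d)"
  unfolding std_gauss_def Rd_def by (intro sets_PiM_cong) auto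

lemma space_std_gauss [simp]: "space (std_gauss d) = space (Rd d)"
  by (rule sets_eq_imp_space_eq) simp

lemma nn_integral_std_gauss_affine:
  "(\<integral>\<^sup>+\<xi>. ennreal (\<Sum>j<d. (a j + \<sigma> * \<xi> j)\<^sup>2) \<partial>std_gauss d) = ennreal ((\<Sum>j<d. (a j)\<^sup>2) + real d * \<sigma>\<^sup>2)"
proof -
  have comp: "(\<integral>\<^sup>+\<xi>. ennreal ((a j + \<sigma> * \<xi> j)\<^sup>2) \<partial>std_gauss d) = ennreal ((a j)\<^sup>2 + \<sigma>\<^sup>2)"
    if "j < d" for j
  proof -
    have "(\<integral>\<^sup>+\<xi>. ennreal ((a j + \<sigma> * \<xi> j)\<^sup>2) \<partial>std_gauss d)
        = (\<integral>\<^sup>+t. ennreal ((a j + \<sigma> * t)\<^sup>2) \<partial>distr (std_gauss d) std_normal (\<lambda>\<xi>. \<xi> j))"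
      using that unfolding std_gauss_def by (subst nn_integral_distr) auto
    also have "distr (std_gauss d) std_normal (\<lambda>\<xi>. \<xi> j) = std_normal"
      unfolding std_gauss_def using that by (intro distr_PiM_component prob_space_std_normal) auto
    finally show ?thesis by (simp add: nn_integral_std_normal_affine_square)
  qed
  have "(\<integral>\<^sup>+\<xi>. ennreal (\<Sum>j<d. (a j + \<sigma> * \<xi> j)\<^sup>2) \<partial>std_gauss d)
      = (\<integral>\<^sup>+\<xi>. (\<Sum>j<d. ennreal ((a j + \<sigma> * \<xi> j)\<^sup>2)) \<partial>std_gauss d)"
    by (simp add: sum_ennreal)
  also have "\<dots> = (\<Sum>j<d. \<integral>\<^sup>+\<xi>. ennreal ((a j + \<sigma> * \<xi> j)\<^sup>2) \<partial>std_gauss d)"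
    unfolding std_gauss_def by (rule nn_integral_sum) auto
  also have "\<dots> = (\<Sum>j<d. ennreal ((a j)\<^sup>2 + \<sigma>\<^sup>2))"
    by (intro sum.cong) (auto simp: comp)
  also have "\<dots> = ennreal ((\<Sum>j<d. (a j)\<^sup>2) + real d * \<sigma>\<^sup>2)"
    by (subst sum_ennreal) (auto simp: sum.distrib)
  finally show ?thesis .
qed

text \<open>
  Conditioning on all coordinates other than \<open>i\<close> reduces the claim to the one-dimensional shift of
  the section \<open>?B w\<close> of \<open>A\<close>.
\<close>

lemma std_gauss_coordinate_shift:
  assumes \<sigma>: "0 < \<sigma>" and A [measurable]: "A \<in> sets (Rd d)" and i: "i < d"
  shows "\<bar>measure (std_gauss d) {\<xi> \<in> space (Rd d). (\<lambda>j\<in>{..<d}. a j + \<sigma> * \<xi> j) \<in> A} -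
      measure (std_gauss d) {\<xi> \<in> space (Rd d). (\<lambda>j\<in>{..<d}. (a(i := r)) j + \<sigma> * \<xi> j) \<in> A}\<bar>
    \<le> \<bar>a i - r\<bar> / \<sigma>"
proof -
  let ?I = "{..<d} - {i}"
  let ?G = "Pi\<^sub>M ?I (\<lambda>_. std_normal)"
  have insert: "insert i ?I = {..<d}" using i by auto
  interpret G: prob_space ?G by (intro prob_space_PiM prob_space_std_normal)
  interpret N: prob_space std_normal by (rule prob_space_std_normal)
  interpret product_sigma_finite "\<lambda>_::nat. std_normal" by standard
  let ?E = "\<lambda>a. {\<xi> \<in> space (Rd d). (\<lambda>j\<in>{..<d}. a j + \<sigma> * \<xi> j) \<in> A}"
  let ?B = "\<lambda>w. {s. (\<lambda>j\<in>{..<d}. if j = i then s else a j + \<sigma> * w j) \<in> A}"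
  let ?q = "\<lambda>s w. measure std_normal {t. s + \<sigma> * t \<in> ?B w}"
  have B [measurable]: "?B w \<in> sets borel" for w
  proof -
    have "(\<lambda>s. \<lambda>j\<in>{..<d}. if j = i then s else a j + \<sigma> * w j) \<in> borel \<rightarrow>\<^sub>M Rd d"
      unfolding Rd_def by (intro measurable_restrict) auto
    from measurable_sets[OF this A] show ?thesis by (simp add: vimage_def)
  qed
  have meas_shift: "(\<lambda>\<xi>. \<lambda>j\<in>{..<d}. b j + \<sigma> * \<xi> j) \<in> Rd d \<rightarrow>\<^sub>M Rd d" for b
    unfolding Rd_def by (intro measurable_restrict) auto
  have E [measurable]: "?E b \<in> sets (Rd d)" for b
    using measurable_sets[OF meas_shift A, of b] by (simp add: vimage_def Int_def conj_commute)
  have upd: "(w(i := t)) \<in> ?E (a(i := s)) \<longleftrightarrow> s + \<sigma> * t \<in> ?B w" if "w \<in> space ?G" for w s t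
  proof -
    have "(w(i := t)) \<in> space (Rd d)"
      using that i by (auto simp: Rd_def space_PiM PiE_def extensional_def)
    moreover have "(\<lambda>j\<in>{..<d}. (a(i := s)) j + \<sigma> * (w(i := t)) j)
        = (\<lambda>j\<in>{..<d}. if j = i then s + \<sigma> * t else a j + \<sigma> * w j)"
      by (auto simp: restrict_def fun_eq_iff)
    ultimately show ?thesis by simp
  qed
  have Bs: "{t. s + \<sigma> * t \<in> ?B w} \<in> sets std_normal" for s w
    using measurable_sets[of "\<lambda>t. s + \<sigma> * t" borel borel "?B w"] B by (simp add: vimage_def)
  have meas_q: "(\<lambda>w. emeasure std_normal {t. s + \<sigma> * t \<in> ?B w}) \<in> borel_measurable ?G" for s
  proof -
    have m: "(\<lambda>p. \<lambda>j\<in>{..<d}. if j = i then s + \<sigma> * snd p else a j + \<sigma> * fst p j)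
        \<in> ?G \<Otimes>\<^sub>M std_normal \<rightarrow>\<^sub>M Rd d"
      unfolding Rd_def
    proof (intro measurable_restrict)
      fix j assume "j \<in> {..<d}"
      then show "(\<lambda>p. if j = i then s + \<sigma> * snd p else a j + \<sigma> * fst p j)
          \<in> borel_measurable (?G \<Otimes>\<^sub>M std_normal)"
        by (cases "j = i") (auto intro!: borel_measurable_add borel_measurable_times
            measurable_compose[OF measurable_fst measurable_component_singleton]
            simp: measurable_snd'')
    qed
    have "(\<lambda>w. \<integral>\<^sup>+t. indicator A (\<lambda>j\<in>{..<d}. if j = i then s + \<sigma> * t else a j + \<sigma> * w j) \<partial>std_normal)
        \<in> borel_measurable ?G"
      using measurable_compose[OF m, of "indicator A" borel] A
      by (intro N.borel_measurable_nn_integral) (simp add: split_beta')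
    moreover have "(\<integral>\<^sup>+t. indicator A (\<lambda>j\<in>{..<d}. if j = i then s + \<sigma> * t else a j + \<sigma> * w j) \<partial>std_normal)
        = emeasure std_normal {t. s + \<sigma> * t \<in> ?B w}" for w
      using nn_integral_indicator[OF Bs[of s w]] by (simp add: indicator_def)
    ultimately show ?thesis by simp
  qed
  have int_q: "integrable ?G (?q s)" for s
    using meas_q[of s]
    by (intro G.integrable_const_bound[of _ 1]) (auto simp: measure_def[abs_def] intro!: AE_I2 N.prob_le_1[unfolded measure_def])
  have rep: "measure (std_gauss d) (?E (a(i := s))) = (\<integral>w. ?q s w \<partial>?G)" for s
  proof -
    have "emeasure (std_gauss d) (?E (a(i := s))) = (\<integral>\<^sup>+\<xi>. indicator (?E (a(i := s))) \<xi> \<partial>std_gauss d)"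
      by simp
    also have "\<dots> = (\<integral>\<^sup>+\<xi>. indicator (?E (a(i := s))) \<xi> \<partial>Pi\<^sub>M (insert i ?I) (\<lambda>_. std_normal))"
      by (simp only: insert std_gauss_def)
    also have "\<dots> = (\<integral>\<^sup>+w. \<integral>\<^sup>+t. indicator (?E (a(i := s))) (w(i := t)) \<partial>std_normal \<partial>?G)"
    proof (rule product_nn_integral_insert)
      have "?E (a(i := s)) \<in> sets (std_gauss d)"
        using E[of "a(i := s)"] by (simp only: sets_std_gauss)
      then show "indicator (?E (a(i := s))) \<in> borel_measurable (Pi\<^sub>M (insert i ?I) (\<lambda>_. std_normal))"
        unfolding insert std_gauss_def by (rule borel_measurable_indicator)
    qed simp_all
    also have "\<dots> = (\<integral>\<^sup>+w. ennreal (?q s w) \<partial>?G)"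
    proof (rule nn_integral_cong)
      fix w assume w: "w \<in> space ?G"
      have "(\<integral>\<^sup>+t. indicator (?E (a(i := s))) (w(i := t)) \<partial>std_normal)
          = (\<integral>\<^sup>+t. indicator {t. s + \<sigma> * t \<in> ?B w} t \<partial>std_normal)"
        using upd[OF w, of _ s] by (intro nn_integral_cong) (simp only: indicator_def mem_Collect_eq)
      also have "\<dots> = emeasure std_normal {t. s + \<sigma> * t \<in> ?B w}"
        by (rule nn_integral_indicator[OF Bs])
      also have "\<dots> = ennreal (?q s w)"
        by (rule N.emeasure_eq_measure)
      finally show "(\<integral>\<^sup>+t. indicator (?E (a(i := s))) (w(i := t)) \<partial>std_normal) = ennreal (?q s w)" .
    qed
    also have "\<dots> = ennreal (\<integral>w. ?q s w \<partial>?G)"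
      by (intro nn_integral_eq_integral int_q) auto
    finally show ?thesis by (simp add: measure_def integral_nonneg_AE)
  qed
  have "\<bar>measure (std_gauss d) (?E (a(i := a i))) - measure (std_gauss d) (?E (a(i := r)))\<bar>
      = \<bar>\<integral>w. ?q (a i) w - ?q r w \<partial>?G\<bar>"
    by (simp only: rep Bochner_Integration.integral_diff[OF int_q int_q])
  also have "\<dots> \<le> (\<integral>w. \<bar>a i - r\<bar> / \<sigma> \<partial>?G)"
    by (intro integral_abs_bound[THEN order_trans] integral_mono integrable_abs
        Bochner_Integration.integrable_diff int_q std_normal_affine_shift[OF \<sigma> B]) simp
  also have "\<dots> = \<bar>a i - r\<bar> / \<sigma>"
    by (simp add: G.prob_space)
  finally show ?thesis by (simp only: fun_upd_triv)
qed

text \<open>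
  Changing the centre one coordinate at a time.  The resulting constant depends on the dimension,
  which affects the constant in front of the exponential rate only.
\<close>

lemma std_gauss_shift:
  assumes \<sigma>: "0 < \<sigma>" and A: "A \<in> sets (Rd d)"
  shows "\<bar>measure (std_gauss d) {\<xi> \<in> space (Rd d). (\<lambda>j\<in>{..<d}. a j + \<sigma> * \<xi> j) \<in> A} -
      measure (std_gauss d) {\<xi> \<in> space (Rd d). (\<lambda>j\<in>{..<d}. b j + \<sigma> * \<xi> j) \<in> A}\<bar>
    \<le> (\<Sum>j<d. \<bar>a j - b j\<bar>) / \<sigma>"
proof -
  let ?u = "\<lambda>a. measure (std_gauss d) {\<xi> \<in> space (Rd d). (\<lambda>j\<in>{..<d}. a j + \<sigma> * \<xi> j) \<in> A}"
  \<comment> \<open>interpolates between \<open>a\<close> at \<open>k = 0\<close> and \<open>b\<close> at \<open>k = d\<close>\<close>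
  define c where "c k j = (if j < k then b j else a j)" for k j :: nat
  have "\<bar>?u (c k) - ?u (c (Suc k))\<bar> \<le> \<bar>a k - b k\<bar> / \<sigma>" if "k < d" for k
  proof -
    have "(c k)(k := b k) = c (Suc k)" "c k k = a k"
      by (auto simp: c_def fun_eq_iff)
    then show ?thesis
      using std_gauss_coordinate_shift[OF \<sigma> A that, of "c k" "b k"] by simp
  qed
  then have "(\<Sum>k<d. \<bar>?u (c k) - ?u (c (Suc k))\<bar>) \<le> (\<Sum>k<d. \<bar>a k - b k\<bar> / \<sigma>)"
    by (intro sum_mono) simp
  moreover have "\<bar>?u (c 0) - ?u (c d)\<bar> \<le> (\<Sum>k<d. \<bar>?u (c k) - ?u (c (Suc k))\<bar>)"
    unfolding sum_lessThan_telescope'[of "\<lambda>k. ?u (c k)", symmetric] by (rule sum_abs)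
  moreover have "?u (c 0) = ?u a" by (simp add: c_def)
  moreover have "?u (c d) = ?u b"
    by (intro arg_cong[where f = "measure (std_gauss d)"] Collect_cong conj_cong refl
        arg_cong[where f = "\<lambda>z. z \<in> A"]) (auto simp: c_def restrict_def)
  ultimately show ?thesis
    by (simp add: sum_divide_distrib)
qed

section \<open>The number of activated midpoints\<close>

abbreviation coins :: "nat \<Rightarrow> (nat \<Rightarrow> bool) measure" where
  "coins K \<equiv> Pi\<^sub>M {..<K} (\<lambda>_. measure_pmf (bernoulli_pmf (1 / real K)))"

text \<open>
  The binomial number of activated midpoints; its mean is \<open>1\<close>, which makes the gradient at the
  current point cancel in expectation.
\<close>

definition hits :: "nat \<Rightarrow> (nat \<Rightarrow> bool) \<Rightarrow> real" where
  "hits K h = (\<Sum>i<K. of_bool (h i))"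

lemma prob_space_coins: "prob_space (coins K)"
  by (intro prob_space_PiM measure_pmf.prob_space_axioms)

lemma measurable_coin [measurable (raw)]:
  assumes "f \<in> N \<rightarrow>\<^sub>M coins K" "i < K"
  shows "(\<lambda>z. of_bool (f z i) :: real) \<in> borel_measurable N"
proof -
  have "(\<lambda>z. f z i) \<in> N \<rightarrow>\<^sub>M measure_pmf (bernoulli_pmf (1 / real K))"
    using assms by (intro measurable_compose[OF assms(1) measurable_component_singleton]) auto
  then show ?thesis
    by (rule measurable_compose) simp
qed

lemma measurable_hits [measurable (raw)]:
  "f \<in> N \<rightarrow>\<^sub>M coins K \<Longrightarrow> (\<lambda>z. hits K (f z)) \<in> borel_measurable N"
  unfolding hits_def by (intro borel_measurable_sum measurable_coin) auto

lemma hits_nonneg [simp]: "0 \<le> hits K h"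
  by (auto simp: hits_def intro!: sum_nonneg)

lemma hits_le: "hits K h \<le> real K"
proof -
  have "hits K h \<le> (\<Sum>i<K. 1)" unfolding hits_def by (intro sum_mono) auto
  then show ?thesis by simp
qed

lemma integrable_coins_bounded:
  fixes f :: "_ \<Rightarrow> real"
  assumes "f \<in> borel_measurable (coins K)" "\<And>h. \<bar>f h\<bar> \<le> c"
  shows "integrable (coins K) f"
proof -
  interpret prob_space "coins K" by (rule prob_space_coins)
  show ?thesis by (rule integrable_const_bound[of _ c]) (use assms in auto)
qed

lemma integral_coins_prod:
  assumes J: "J \<subseteq> {..<K}"
  shows "(\<integral>h. (\<Prod>k\<in>J. of_bool (h k)) \<partial>coins K) = (1 / real K) ^ card J"
proof -
  interpret product_sigma_finite "\<lambda>_::nat. measure_pmf (bernoulli_pmf (1 / real K))" by standard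
  let ?f = "\<lambda>k b. if k \<in> J then of_bool b else (1 :: real)"
  have int: "(\<integral>b. ?f k b \<partial>measure_pmf (bernoulli_pmf (1 / real K))) = (if k \<in> J then 1 / real K else 1)" for k
    by (cases "K = 0") (auto simp: field_simps)
  have "(\<integral>h. (\<Prod>k\<in>J. of_bool (h k)) \<partial>coins K) = (\<integral>h. (\<Prod>k<K. ?f k (h k)) \<partial>coins K)"
    using J by (intro Bochner_Integration.integral_cong refl prod.mono_neutral_cong_left) auto
  also have "\<dots> = (\<Prod>k<K. if k \<in> J then 1 / real K else 1)"
    by (subst product_integral_prod) (auto simp: int integrable_measure_pmf_finite)
  also have "\<dots> = (\<Prod>k\<in>J. 1 / real K)"
    using J by (intro prod.mono_neutral_cong_right) auto
  finally show ?thesis by simp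
qed

lemma integral_hits: "1 \<le> K \<Longrightarrow> (\<integral>h. hits K h \<partial>coins K) = 1"
proof -
  assume K: "1 \<le> K"
  have "(\<integral>h. hits K h \<partial>coins K) = (\<Sum>i<K. \<integral>h. of_bool (h i) \<partial>coins K)"
    unfolding hits_def
    by (intro Bochner_Integration.integral_sum integrable_coins_bounded[of _ _ 1] measurable_coin) auto
  also have "\<dots> = (\<Sum>i<K. 1 / real K)"
  proof (rule sum.cong)
    fix i assume "i \<in> {..<K}"
    then show "(\<integral>h. of_bool (h i) \<partial>coins K) = 1 / real K"
      using integral_coins_prod[of "{i}" K] by simp
  qed simp
  finally show ?thesis using K by simp
qed

lemma integral_hits_square: "1 \<le> K \<Longrightarrow> (\<integral>h. (hits K h)\<^sup>2 \<partial>coins K) \<le> 2"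
proof -
  assume K: "1 \<le> K"
  have pair: "(\<integral>h. of_bool (h i) * of_bool (h j) \<partial>coins K) \<le> of_bool (i = j) / real K + 1 / (real K)\<^sup>2"
    if "i < K" "j < K" for i j
  proof (cases "i = j")
    case True
    have "(\<integral>h. of_bool (h i) * of_bool (h j) \<partial>coins K) = (\<integral>h. of_bool (h j) \<partial>coins K :: real)"
      unfolding True by (rule Bochner_Integration.integral_cong) simp_all
    then show ?thesis using integral_coins_prod[of "{j}" K] that True by simp
  next
    case False
    then show ?thesis using integral_coins_prod[of "{i, j}" K] that
      by (simp add: power2_eq_square)
  qed
  have "(\<integral>h. (hits K h)\<^sup>2 \<partial>coins K) = (\<integral>h. (\<Sum>i<K. \<Sum>j<K. of_bool (h i) * of_bool (h j)) \<partial>coins K)"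
    unfolding hits_def power2_eq_square sum_product ..
  also have "\<dots> = (\<Sum>i<K. \<Sum>j<K. \<integral>h. of_bool (h i) * of_bool (h j) \<partial>coins K)"
  proof -
    have int: "integrable (coins K) (\<lambda>h. of_bool (h i) * of_bool (h j) :: real)" if "i < K" "j < K" for i j
      using that by (intro integrable_coins_bounded[of _ _ 1] borel_measurable_times measurable_coin) auto
    have "(\<integral>h. (\<Sum>i<K. \<Sum>j<K. of_bool (h i) * of_bool (h j)) \<partial>coins K)
        = (\<Sum>i<K. \<integral>h. (\<Sum>j<K. of_bool (h i) * of_bool (h j)) \<partial>coins K :: real)"
      by (rule Bochner_Integration.integral_sum, rule Bochner_Integration.integrable_sum) (simp add: int)
    also have "\<dots> = (\<Sum>i<K. \<Sum>j<K. \<integral>h. of_bool (h i) * of_bool (h j) \<partial>coins K)"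
      by (intro sum.cong refl Bochner_Integration.integral_sum) (simp add: int)
    finally show ?thesis .
  qed
  also have "\<dots> \<le> (\<Sum>i<K. \<Sum>j<K. of_bool (i = j) / real K + 1 / (real K)\<^sup>2)"
    by (intro sum_mono pair) auto
  also have "\<dots> = (\<Sum>i<K. 1 / real K + real K / (real K)\<^sup>2)"
  proof (rule sum.cong)
    fix i assume "i \<in> {..<K}"
    then have "(\<Sum>j<K. of_bool (i = j)) = (1 :: real)"
      by (simp add: of_bool_def)
    then show "(\<Sum>j<K. of_bool (i = j) / real K + 1 / (real K)\<^sup>2) = 1 / real K + real K / (real K)\<^sup>2"
      by (simp add: sum.distrib flip: sum_divide_distrib)
  qed simp
  also have "\<dots> = 2"
    using K by (simp add: power2_eq_square field_simps)
  finally show ?thesis .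
qed

section \<open>Euclidean geometry in coordinates\<close>

abbreviation sq :: "nat \<Rightarrow> rvec \<Rightarrow> real" where
  "sq d x \<equiv> inner_Rd d x x"

lemma sq_nonneg [simp]: "0 \<le> sq d x"
  by (simp add: inner_Rd_def sum_nonneg)

lemma norm_Rd_square [simp]: "(norm_Rd d x)\<^sup>2 = sq d x"
  by (simp add: norm_Rd_def)

lemma norm_Rd_nonneg [simp]: "0 \<le> norm_Rd d x"
  by (simp add: norm_Rd_def)

lemma inner_Rd_commute: "inner_Rd d x y = inner_Rd d y x"
  by (simp add: inner_Rd_def mult.commute)

lemma inner_Rd_cong:
  "(\<And>j. j < d \<Longrightarrow> x j = x' j) \<Longrightarrow> (\<And>j. j < d \<Longrightarrow> y j = y' j) \<Longrightarrow> inner_Rd d x y = inner_Rd d x' y'"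
  by (simp add: inner_Rd_def)

lemma inner_Rd_lincomb:
  assumes "\<And>j. j < d \<Longrightarrow> z j = a * u j + b * v j"
  shows "inner_Rd d z w = a * inner_Rd d u w + b * inner_Rd d v w"
  using assms by (simp add: inner_Rd_def sum_distrib_left sum.distrib[symmetric] algebra_simps)

lemma sq_lincomb:
  assumes "\<And>j. j < d \<Longrightarrow> z j = a * u j + b * v j"
  shows "sq d z = a\<^sup>2 * sq d u + 2 * a * b * inner_Rd d u v + b\<^sup>2 * sq d v"
proof -
  have "sq d z = a * inner_Rd d z u + b * inner_Rd d z v"
    using inner_Rd_lincomb[OF assms, where w = z] by (simp add: inner_Rd_commute[of d z u] inner_Rd_commute[of d z v])
  also have "inner_Rd d z u = a * sq d u + b * inner_Rd d v u"
    using assms by (rule inner_Rd_lincomb)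
  also have "inner_Rd d z v = a * inner_Rd d u v + b * sq d v"
    using assms by (rule inner_Rd_lincomb)
  finally show ?thesis
    by (simp add: inner_Rd_commute[of d v u] power2_eq_square algebra_simps)
qed

lemma Young:
  assumes "0 < c"
  shows "2 * \<bar>inner_Rd d u v\<bar> \<le> c * sq d u + sq d v / c"
proof -
  have "0 \<le> sq d (\<lambda>j. c * u j + s * v j)" for s by simp
  then have "0 \<le> c\<^sup>2 * sq d u + 2 * c * s * inner_Rd d u v + s\<^sup>2 * sq d v" for s
    using sq_lincomb[of d "\<lambda>j. c * u j + s * v j" c u s v] by metis
  from this[of 1] this[of "-1"]
  have "c * (2 * \<bar>inner_Rd d u v\<bar>) \<le> c * (c * sq d u + sq d v / c)"
    using assms by (auto simp: abs_if power2_eq_square algebra_simps)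
  then show ?thesis using assms by (rule mult_left_le_imp_le)
qed

lemma sq_diff_Rd: "sq d (diff_Rd d x y) = sq d x - 2 * inner_Rd d x y + sq d y"
  using sq_lincomb[of d "diff_Rd d x y" 1 x "-1" y] by (simp add: diff_Rd_def)

lemma sq_diff_le: "sq d (diff_Rd d x y) \<le> 2 * sq d x + 2 * sq d y"
  using Young[of 1 d x y] by (simp add: sq_diff_Rd)

lemma abs_coordinate_le: "j < d \<Longrightarrow> \<bar>x j\<bar> \<le> norm_Rd d x"
proof -
  assume "j < d"
  then have "x j * x j \<le> sq d x"
    unfolding inner_Rd_def by (intro member_le_sum) auto
  then show ?thesis by (simp add: norm_Rd_def real_le_rsqrt power2_eq_square)
qed

text \<open>
  Cauchy--Schwarz with weights in \<open>{0, 1}\<close>: only the activated terms are counted, so the factor is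
  the number of hits instead of \<open>K\<close>.  This keeps the contraction and drift estimates uniform in
  \<open>K\<close>.
\<close>

lemma sq_coin_sum_le:
  "sq d (\<lambda>j. \<Sum>i<K. of_bool (h i) * v i j) \<le> hits K h * (\<Sum>i<K. of_bool (h i) * sq d (v i))"
proof -
  have "sq d (\<lambda>j. \<Sum>i<K. of_bool (h i) * v i j) = (\<Sum>j<d. (\<Sum>i<K. of_bool (h i) * v i j)\<^sup>2)"
    by (simp add: inner_Rd_def power2_eq_square)
  also have "\<dots> \<le> (\<Sum>j<d. hits K h * (\<Sum>i<K. of_bool (h i) * (v i j)\<^sup>2))"
  proof (rule sum_mono)
    fix j
    have "(\<Sum>i<K. of_bool (h i) * (of_bool (h i) * v i j))\<^sup>2
        \<le> (\<Sum>i<K. (of_bool (h i))\<^sup>2) * (\<Sum>i<K. (of_bool (h i) * v i j)\<^sup>2)"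
      by (rule Cauchy_Schwarz_ineq_sum)
    moreover have "of_bool b * (of_bool b * r) = of_bool b * r" "(of_bool b)\<^sup>2 = (of_bool b :: real)"
      "(of_bool b * r)\<^sup>2 = of_bool b * r\<^sup>2" for b and r :: real
      by (cases b; simp)+
    ultimately show "(\<Sum>i<K. of_bool (h i) * v i j)\<^sup>2 \<le> hits K h * (\<Sum>i<K. of_bool (h i) * (v i j)\<^sup>2)"
      by (simp add: hits_def)
  qed
  also have "\<dots> = hits K h * (\<Sum>j<d. \<Sum>i<K. of_bool (h i) * (v i j)\<^sup>2)"
    by (simp add: sum_distrib_left)
  also have "(\<Sum>j<d. \<Sum>i<K. of_bool (h i) * (v i j)\<^sup>2) = (\<Sum>i<K. of_bool (h i) * sq d (v i))"
    by (subst sum.swap) (simp add: inner_Rd_def sum_distrib_left power2_eq_square)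
  finally show ?thesis .
qed

lemma space_Rd: "space (Rd d) = extensional {..<d}"
  by (simp add: Rd_def space_PiM PiE_def)

lemma diff_Rd_apply [simp]: "j < d \<Longrightarrow> diff_Rd d x y j = x j - y j"
  by (simp add: diff_Rd_def)

section \<open>Gradients of smooth strongly convex functions\<close>

locale strongly_convex_smooth =
  fixes d :: nat and U :: "rvec \<Rightarrow> real" and m L :: real
  assumes m: "0 < m" and mL: "m \<le> L"
    and C1: "C1_on_Rd d U"
    and grad_zero: "grad d U (zero_vec d) = zero_vec d"
    and lower: "\<And>x y. x \<in> space (Rd d) \<Longrightarrow> y \<in> space (Rd d) \<Longrightarrow>
      m / 2 * sq d (diff_Rd d x y) \<le> U y - U x - inner_Rd d (grad d U x) (diff_Rd d y x)"
    and upper: "\<And>x y. x \<in> space (Rd d) \<Longrightarrow> y \<in> space (Rd d) \<Longrightarrow>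
      U y - U x - inner_Rd d (grad d U x) (diff_Rd d y x) \<le> L / 2 * sq d (diff_Rd d x y)"
begin

lemma L: "0 < L"
  using m mL by simp

lemma sq_diff_commute: "sq d (diff_Rd d x y) = sq d (diff_Rd d y x)"
  by (simp add: inner_Rd_def power2_eq_square algebra_simps)

lemma
  assumes "x \<in> space (Rd d)" "y \<in> space (Rd d)"
  defines "p \<equiv> inner_Rd d (diff_Rd d x y) (diff_Rd d (grad d U x) (grad d U y))"
  shows grad_strongly_monotone: "m * sq d (diff_Rd d x y) \<le> p"
    and grad_inner_le: "p \<le> L * sq d (diff_Rd d x y)"
proof -
  have "p = - inner_Rd d (grad d U x) (diff_Rd d y x) - inner_Rd d (grad d U y) (diff_Rd d x y)"
    unfolding p_def inner_Rd_def
    by (simp add: algebra_simps flip: sum.distrib sum_subtractf sum_negf)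
  then have p: "p = (U y - U x - inner_Rd d (grad d U x) (diff_Rd d y x))
      + (U x - U y - inner_Rd d (grad d U y) (diff_Rd d x y))"
    by simp
  have halves: "c * sq d (diff_Rd d x y) = c / 2 * sq d (diff_Rd d x y) + c / 2 * sq d (diff_Rd d y x)" for c
    by (simp add: sq_diff_commute[of y x])
  show "m * sq d (diff_Rd d x y) \<le> p"
    unfolding p by (subst halves, intro add_mono lower assms(1,2))
  show "p \<le> L * sq d (diff_Rd d x y)"
    unfolding p by (subst halves, intro add_mono upper assms(1,2))
qed

text \<open>
  The subtangent bound at \<open>x\<close> and the quadratic upper bound at \<open>y\<close> are compared at the point \<open>w\<close> that
  a gradient step of length \<open>1 / L\<close> reaches from \<open>y\<close>, for the function \<open>U\<close> minus its linear part at
  \<open>x\<close>.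
\<close>

lemma grad_Lipschitz:
  assumes x: "x \<in> space (Rd d)" and y: "y \<in> space (Rd d)"
  shows "sq d (diff_Rd d (grad d U x) (grad d U y)) \<le> L\<^sup>2 * sq d (diff_Rd d x y)"
proof -
  let ?g = "diff_Rd d (grad d U y) (grad d U x)"
  \<comment> \<open>the minimiser of the quadratic upper bound at \<open>y\<close>\<close>
  define w where "w = (\<lambda>j\<in>{..<d}. y j - ?g j / L)"
  have half: "a / 2 \<le> c / 2 * b \<Longrightarrow> a \<le> c * b" for a b c :: real by simp
  have w: "w \<in> space (Rd d)" by (simp add: w_def space_Rd)
  have "0 \<le> m / 2 * sq d (diff_Rd d x w)" using m by simp
  also note lower[OF x w]
  finally have 1: "0 \<le> U w - U x - inner_Rd d (grad d U x) (diff_Rd d w x)" .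
  have 2: "inner_Rd d (grad d U x) (diff_Rd d w x)
      = inner_Rd d (grad d U x) (diff_Rd d y x) - inner_Rd d (grad d U x) ?g / L"
    using inner_Rd_lincomb[of d "diff_Rd d w x" 1 "diff_Rd d y x" "- 1 / L" ?g "grad d U x"]
    by (simp add: w_def inner_Rd_commute)
  have 3: "inner_Rd d (grad d U y) (diff_Rd d w y) = - inner_Rd d (grad d U y) ?g / L"
    using inner_Rd_lincomb[of d "diff_Rd d w y" "- 1 / L" ?g 0 ?g "grad d U y"]
    by (simp add: w_def inner_Rd_commute)
  have 4: "sq d (diff_Rd d y w) = sq d ?g / L\<^sup>2"
    using sq_lincomb[of d "diff_Rd d y w" "1 / L" ?g 0 ?g]
    by (simp add: w_def power_divide)
  have 5: "sq d ?g = inner_Rd d (grad d U y) ?g - inner_Rd d (grad d U x) ?g"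
    using inner_Rd_lincomb[of d ?g 1 "grad d U y" "- 1" "grad d U x" ?g] by simp
  have "U w - U y - inner_Rd d (grad d U y) (diff_Rd d w y) \<le> L / 2 * (sq d ?g / L\<^sup>2)"
    using upper[OF y w] by (simp only: 4)
  also have "L / 2 * (sq d ?g / L\<^sup>2) = (inner_Rd d (grad d U y) ?g - inner_Rd d (grad d U x) ?g) / L / 2"
    using L unfolding 5[symmetric] by (simp add: power2_eq_square)
  finally have "(inner_Rd d (grad d U y) ?g - inner_Rd d (grad d U x) ?g) / L / 2
      \<le> U y - U x - inner_Rd d (grad d U x) (diff_Rd d y x)"
    using 1 unfolding 2 3 diff_divide_distrib by simp
  also have "\<dots> \<le> L / 2 * sq d (diff_Rd d x y)"
    by (rule upper[OF x y])
  finally have "sq d ?g / L \<le> L * sq d (diff_Rd d x y)"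
    unfolding 5 by (rule half)
  then have "sq d ?g \<le> L\<^sup>2 * sq d (diff_Rd d x y)"
    using L by (simp add: field_simps power2_eq_square)
  then show ?thesis by (simp only: sq_diff_commute[of "grad d U x"])
qed

lemma zero_in_space [simp]: "zero_vec d \<in> space (Rd d)"
  by (simp add: zero_vec_def space_Rd)

lemma sq_grad_le:
  assumes "x \<in> space (Rd d)"
  shows "sq d (grad d U x) \<le> L\<^sup>2 * sq d x"
proof -
  have "sq d (diff_Rd d z (zero_vec d)) = sq d z" for z
    by (intro inner_Rd_cong) (simp_all add: zero_vec_def)
  then show ?thesis using grad_Lipschitz[OF assms zero_in_space] by (simp add: grad_zero)
qed

text \<open>
  Each partial derivative is continuous in the product topology of \<open>nat \<Rightarrow> real\<close>, while measurability
  refers to the finite product \<open>Rd d\<close>; the inclusion of \<open>Rd d\<close> is measurable because every coordinate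
  beyond \<open>d\<close> is constant.
\<close>

lemma measurable_grad [measurable (raw)]:
  assumes f: "f \<in> N \<rightarrow>\<^sub>M Rd d" and j: "j < d"
  shows "(\<lambda>z. grad d U (f z) j) \<in> borel_measurable N"
proof -
  have "continuous_on (space (Rd d)) (\<lambda>x. grad d U x j)"
    using C1 j by (simp add: C1_on_Rd_def)
  then have "(\<lambda>x. grad d U x j) \<in> borel_measurable (restrict_space borel (space (Rd d)))"
    by (rule borel_measurable_continuous_on_restrict)
  moreover have "(\<lambda>x. x) \<in> Rd d \<rightarrow>\<^sub>M restrict_space borel (space (Rd d))"
  proof (rule measurable_restrict_space2)
    have "(\<lambda>x. x) \<in> Rd d \<rightarrow>\<^sub>M Pi\<^sub>M UNIV (\<lambda>_. borel)"
    proof (rule measurable_PiM_single')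
      fix i :: nat
      show "(\<lambda>x. x i) \<in> borel_measurable (Rd d)"
      proof (cases "i < d")
        case True
        then show ?thesis unfolding Rd_def by (intro measurable_component_singleton) simp
      next
        case False
        then have "x i = undefined" if "x \<in> space (Rd d)" for x
          using that by (simp add: space_Rd extensional_def)
        then show ?thesis by (subst measurable_cong[where g = "\<lambda>_. undefined"]) auto
      qed
    qed auto
    then show "(\<lambda>x. x) \<in> borel_measurable (Rd d)"
      by (simp add: sets_PiM_equal_borel cong: measurable_cong_sets)
  qed simp
  ultimately have "(\<lambda>x. grad d U x j) \<in> borel_measurable (Rd d)"
    by (rule measurable_compose[rotated])
  then show ?thesis by (rule measurable_compose[OF f])
qed

end

section \<open>One step of the chain, pathwise\<close>

context strongly_convex_smooth
begin

text \<open>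
  A lower bound for the strong convexity constant seen between the current point and a midpoint.
\<close>

abbreviation margin :: "real \<Rightarrow> real" where
  "margin \<eta> \<equiv> m - 4 * \<eta> * L\<^sup>2"

text \<open>
  Here \<open>u\<close> is the difference of two states, \<open>g\<close> that of their gradients, and \<open>u'\<close>, \<open>g'\<close> are the
  same differences for their midpoints.  Two coupled midpoints use the same Gaussian, so
  \<open>u' = u - c g\<close> with a deterministic \<open>c \<le> \<eta>\<close>; strong convexity between the midpoints therefore
  transfers to the direction \<open>u\<close> up to an error of order \<open>\<eta> L\<^sup>2\<close>.
\<close>

lemma midpoint_inner_bounds:
  assumes \<eta>: "0 < \<eta>" "\<eta> * L \<le> 1 / 100" and c: "0 \<le> c" "c \<le> \<eta>"
    and p: "m * sq d u \<le> inner_Rd d u g" "inner_Rd d u g \<le> L * sq d u"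
    and g: "sq d g \<le> L\<^sup>2 * sq d u"
    and u': "\<And>j. j < d \<Longrightarrow> u' j = u j - c * g j"
    and p': "m * sq d u' \<le> inner_Rd d u' g'" and g': "sq d g' \<le> L\<^sup>2 * sq d u'"
  shows "margin \<eta> * sq d u \<le> inner_Rd d u g'" and "sq d (diff_Rd d g g') \<le> 6 * L\<^sup>2 * sq d u"
proof -
  let ?s = "sq d u"
  have s': "sq d u' = ?s - 2 * c * inner_Rd d u g + c\<^sup>2 * sq d g"
    using sq_lincomb[of d u' 1 u "- c" g] u' by simp
  have nonneg: "0 \<le> inner_Rd d u g"
    using p(1) m by (smt (verit) mult_nonneg_nonneg sq_nonneg)
  have "c * L \<le> \<eta> * L"
    using c(2) L by (intro mult_right_mono) auto
  then have "c * L \<le> 1 / 100" using \<eta>(2) by linarith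
  then have cL: "0 \<le> c * L" "c * L \<le> 1 / 100"
    using c(1) L by auto
  have "c\<^sup>2 * sq d g \<le> c\<^sup>2 * (L\<^sup>2 * ?s)"
    using g by (intro mult_left_mono) auto
  also have "\<dots> = (c * L)\<^sup>2 * ?s" by (simp add: power_mult_distrib)
  also have "\<dots> \<le> 1 * ?s"
    using cL by (intro mult_right_mono power_le_one) auto
  finally have "sq d u' \<le> 2 * ?s"
    using s' nonneg c by (smt (verit) mult_nonneg_nonneg)
  then have g'': "sq d g' \<le> 2 * L\<^sup>2 * ?s"
    using g' mult_left_mono[of "sq d u'" "2 * ?s" "L\<^sup>2"] by simp
  have "2 * c * inner_Rd d u g \<le> 2 * \<eta> * (L * ?s)"
    using c p(2) nonneg by (intro mult_mono) auto
  then have "?s - 2 * \<eta> * (L * ?s) \<le> sq d u'"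
    using s' by (smt (verit) mult_nonneg_nonneg sq_nonneg zero_le_power2)
  then have "m * (?s - 2 * \<eta> * (L * ?s)) \<le> inner_Rd d u' g'"
    using p' m by (smt (verit) mult_left_mono)
  moreover have "m * (2 * \<eta> * (L * ?s)) \<le> L * (2 * \<eta> * (L * ?s))"
    using mL L \<eta> by (intro mult_right_mono) auto
  moreover have "inner_Rd d u' g' = inner_Rd d u g' - c * inner_Rd d g g'"
    using inner_Rd_lincomb[of d u' 1 u "- c" g g'] u' by simp
  moreover have "- (c * inner_Rd d g g') \<le> \<eta> * (3 / 2 * L\<^sup>2 * ?s)"
  proof -
    have "2 * \<bar>inner_Rd d g g'\<bar> \<le> 3 * L\<^sup>2 * ?s"
      using Young[of 1 d g g'] g g'' by simp
    then have "c * \<bar>inner_Rd d g g'\<bar> \<le> \<eta> * (3 / 2 * L\<^sup>2 * ?s)"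
      using c by (intro mult_mono) auto
    moreover have "- (c * inner_Rd d g g') \<le> c * \<bar>inner_Rd d g g'\<bar>"
      using c by (smt (verit) mult_minus_right mult_left_mono)
    ultimately show ?thesis by linarith
  qed
  ultimately have 1: "m * ?s - 7 / 2 * (\<eta> * L\<^sup>2 * ?s) \<le> inner_Rd d u g'"
    by (simp add: power2_eq_square algebra_simps)
  have "0 \<le> \<eta> * L\<^sup>2 * ?s" using \<eta> by simp
  with 1 show "margin \<eta> * ?s \<le> inner_Rd d u g'"
    by (simp add: algebra_simps)
  show "sq d (diff_Rd d g g') \<le> 6 * L\<^sup>2 * ?s"
    using sq_diff_le[of d g g'] g g'' by linarith
qed

text \<open>
  The part of a step that precedes the addition of the Gaussian \<open>sqrt (2 \<eta>) \<xi>\<close>.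
\<close>

definition drift :: "nat \<Rightarrow> real \<Rightarrow> rvec \<Rightarrow> (nat \<Rightarrow> bool) \<Rightarrow> (nat \<Rightarrow> rvec) \<Rightarrow> rvec" where
  "drift K \<eta> x h \<zeta> = (\<lambda>j\<in>{..<d}. x j - \<eta> * grad d U x j
     + \<eta> * (\<Sum>i<K. of_bool (h i) * (grad d U x j - grad d U (prlmc_mid d K U \<eta> i x (\<zeta> i)) j)))"

lemma prlmc_step_eq:
  "prlmc_step d K U \<eta> x (h, \<xi>, \<zeta>) = (\<lambda>j\<in>{..<d}. drift K \<eta> x h \<zeta> j + sqrt (2 * \<eta>) * \<xi> j)"
  by (auto simp: prlmc_step_def drift_def restrict_def fun_eq_iff)

lemma prlmc_mid_in_space [simp]: "prlmc_mid d K U \<eta> i x z \<in> space (Rd d)"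
  by (simp add: prlmc_mid_def space_Rd)

text \<open>
  An upper bound for the squared distance of two coupled copies after one step, in terms of their
  squared distance \<open>s\<close>, the inner product \<open>p\<close> of the differences of states and gradients, and the
  number \<open>n\<close> of hits.  When \<open>n\<close> has mean \<open>1\<close>, the unknown quantity \<open>p\<close> cancels in expectation.
\<close>

definition contraction_bound :: "real \<Rightarrow> real \<Rightarrow> real \<Rightarrow> real \<Rightarrow> real" where
  "contraction_bound \<eta> s p n = s - 2 * \<eta> * (p - n * (p - margin \<eta> * s)) + \<eta>\<^sup>2 * ((2 + 12 * n\<^sup>2) * L\<^sup>2 * s)"

text \<open>
  The difference of the two copies after the step is \<open>u - \<eta> (g - S)\<close>, where \<open>S\<close> sums \<open>g - g' i\<close> over
  the activated midpoints.  The midpoint Gaussians enter only through quantities which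
  \<open>midpoint_inner_bounds\<close> bounds deterministically, so the bound is pathwise.
\<close>

lemma drift_difference_bound:
  assumes \<eta>: "0 < \<eta>" "\<eta> * L \<le> 1 / 100" and x: "x \<in> space (Rd d)" and y: "y \<in> space (Rd d)"
  shows "sq d (diff_Rd d (drift K \<eta> x h \<zeta>) (drift K \<eta> y h \<zeta>))
    \<le> contraction_bound \<eta> (sq d (diff_Rd d x y))
        (inner_Rd d (diff_Rd d x y) (diff_Rd d (grad d U x) (grad d U y))) (hits K h)"
proof -
  define u g where "u = diff_Rd d x y" and "g = diff_Rd d (grad d U x) (grad d U y)"
  define g' where "g' i = diff_Rd d (grad d U (prlmc_mid d K U \<eta> i x (\<zeta> i)))
    (grad d U (prlmc_mid d K U \<eta> i y (\<zeta> i)))" for i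
  define S where "S j = (\<Sum>i<K. of_bool (h i) * diff_Rd d g (g' i) j)" for j
  define p where "p = inner_Rd d u g"
  let ?s = "sq d u"
  have p: "m * ?s \<le> p" "p \<le> L * ?s"
    unfolding p_def u_def g_def by (rule grad_strongly_monotone grad_inner_le x y)+
  have g: "sq d g \<le> L\<^sup>2 * ?s"
    unfolding g_def u_def by (rule grad_Lipschitz x y)+
  have mid: "margin \<eta> * ?s \<le> inner_Rd d u (g' i)" "sq d (diff_Rd d g (g' i)) \<le> 6 * L\<^sup>2 * ?s"
    if "i < K" for i
  proof -
    let ?c = "real i * \<eta> / real K"
    let ?u' = "diff_Rd d (prlmc_mid d K U \<eta> i x (\<zeta> i)) (prlmc_mid d K U \<eta> i y (\<zeta> i))"
    have c: "0 \<le> ?c" "?c \<le> \<eta>"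
      using that \<eta>(1) by (auto simp: field_simps)
    have u': "?u' j = u j - ?c * g j" if "j < d" for j
      using that by (simp add: u_def g_def prlmc_mid_def algebra_simps)
    have "m * sq d ?u' \<le> inner_Rd d ?u' (g' i)"
      unfolding g'_def by (rule grad_strongly_monotone) simp_all
    moreover have "sq d (g' i) \<le> L\<^sup>2 * sq d ?u'"
      unfolding g'_def by (rule grad_Lipschitz) simp_all
    ultimately show "margin \<eta> * ?s \<le> inner_Rd d u (g' i)" "sq d (diff_Rd d g (g' i)) \<le> 6 * L\<^sup>2 * ?s"
      using midpoint_inner_bounds[OF \<eta> c p[unfolded p_def] g u'] by auto
  qed
  have inner_S: "inner_Rd d u S = (\<Sum>i<K. of_bool (h i) * (p - inner_Rd d u (g' i)))"
  proof -
    have "inner_Rd d u S = (\<Sum>i<K. of_bool (h i) * inner_Rd d u (diff_Rd d g (g' i)))"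
      unfolding inner_Rd_def S_def
      by (subst sum_distrib_left, subst sum.swap) (simp add: sum_distrib_left mult_ac)
    moreover have "inner_Rd d u (diff_Rd d g (g' i)) = p - inner_Rd d u (g' i)" for i
      using inner_Rd_lincomb[of d "diff_Rd d g (g' i)" 1 g "- 1" "g' i" u]
      by (simp add: p_def inner_Rd_commute)
    ultimately show ?thesis by simp
  qed
  have "inner_Rd d u S \<le> (\<Sum>i<K. of_bool (h i) * (p - margin \<eta> * ?s))"
    unfolding inner_S by (intro sum_mono mult_left_mono diff_left_mono mid) auto
  then have inner_le: "inner_Rd d u S \<le> hits K h * (p - margin \<eta> * ?s)"
    by (simp only: hits_def sum_distrib_right)
  have "sq d S \<le> hits K h * (\<Sum>i<K. of_bool (h i) * sq d (diff_Rd d g (g' i)))"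
    unfolding S_def by (rule sq_coin_sum_le)
  also have "\<dots> \<le> hits K h * (\<Sum>i<K. of_bool (h i) * (6 * L\<^sup>2 * ?s))"
    by (intro mult_left_mono sum_mono mid) auto
  also have "\<dots> = (hits K h)\<^sup>2 * (6 * L\<^sup>2 * ?s)"
    by (simp only: hits_def sum_distrib_right power2_eq_square mult.assoc)
  finally have S: "sq d S \<le> (hits K h)\<^sup>2 * (6 * L\<^sup>2 * ?s)" .
  have "sq d (diff_Rd d g S) \<le> 2 * (L\<^sup>2 * ?s) + 2 * ((hits K h)\<^sup>2 * (6 * L\<^sup>2 * ?s))"
    using sq_diff_le[of d g S] g S by linarith
  also have "\<dots> = (2 + 12 * (hits K h)\<^sup>2) * L\<^sup>2 * ?s"
    by (simp add: algebra_simps)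
  finally have R: "\<eta>\<^sup>2 * sq d (diff_Rd d g S) \<le> \<eta>\<^sup>2 * ((2 + 12 * (hits K h)\<^sup>2) * L\<^sup>2 * ?s)"
    by (intro mult_left_mono) auto
  have "sq d (diff_Rd d (drift K \<eta> x h \<zeta>) (drift K \<eta> y h \<zeta>))
      = ?s - 2 * \<eta> * inner_Rd d u (diff_Rd d g S) + \<eta>\<^sup>2 * sq d (diff_Rd d g S)"
  proof -
    have "diff_Rd d (drift K \<eta> x h \<zeta>) (drift K \<eta> y h \<zeta>) j = 1 * u j + (- \<eta>) * diff_Rd d g S j"
      if "j < d" for j
    proof -
      define T where "T z = (\<Sum>i<K. of_bool (h i) *
        (grad d U z j - grad d U (prlmc_mid d K U \<eta> i z (\<zeta> i)) j))" for z
      have "S j = T x - T y"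
        unfolding T_def sum_subtractf[symmetric] S_def using that
        by (intro sum.cong) (simp_all add: g_def g'_def algebra_simps)
      then have "T x = S j + T y" by simp
      moreover have "drift K \<eta> z h \<zeta> j = z j - \<eta> * grad d U z j + \<eta> * T z" for z
        using that by (simp add: drift_def T_def)
      ultimately show ?thesis
        using that by (simp add: u_def g_def algebra_simps)
    qed
    from sq_lincomb[OF this] show ?thesis by simp
  qed
  also have "inner_Rd d u (diff_Rd d g S) = p - inner_Rd d u S"
    using inner_Rd_lincomb[of d "diff_Rd d g S" 1 g "- 1" S u]
    by (simp add: p_def inner_Rd_commute)
  finally have "sq d (diff_Rd d (drift K \<eta> x h \<zeta>) (drift K \<eta> y h \<zeta>))
      = ?s - 2 * \<eta> * (p - inner_Rd d u S) + \<eta>\<^sup>2 * sq d (diff_Rd d g S)" .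
  moreover have "2 * \<eta> * (p - hits K h * (p - margin \<eta> * ?s)) \<le> 2 * \<eta> * (p - inner_Rd d u S)"
    using inner_le \<eta> by (intro mult_left_mono) auto
  ultimately show ?thesis
    using R unfolding contraction_bound_def u_def[symmetric] g_def[symmetric] p_def[symmetric]
    by linarith
qed

lemma
  assumes \<eta>: "0 < \<eta>" "\<eta> * L\<^sup>2 \<le> m / 100" and K: "1 \<le> K" and s: "0 \<le> s"
  shows integrable_contraction_bound:
      "integrable (coins K) (\<lambda>h. contraction_bound \<eta> s p (hits K h))" (is ?A)
    and integral_contraction_bound:
      "(\<integral>h. contraction_bound \<eta> s p (hits K h) \<partial>coins K) \<le> (1 - 3 / 2 * \<eta> * m) * s" (is ?B)
proof -
  interpret prob_space "coins K" by (rule prob_space_coins)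
  have int1: "integrable (coins K) (\<lambda>h. hits K h)"
    by (rule integrable_coins_bounded[of _ _ "real K"]) (auto simp: hits_le)
  have int2: "integrable (coins K) (\<lambda>h. (hits K h)\<^sup>2)"
    by (rule integrable_coins_bounded[of _ _ "(real K)\<^sup>2"]) (auto simp: hits_le power_mono)
  have eq: "contraction_bound \<eta> s p n = (s - 2 * \<eta> * p + 2 * \<eta>\<^sup>2 * L\<^sup>2 * s)
      + 2 * \<eta> * (p - margin \<eta> * s) * n + 12 * \<eta>\<^sup>2 * L\<^sup>2 * s * n\<^sup>2" for n
    by (simp add: contraction_bound_def algebra_simps)
  show ?A unfolding eq
    by (intro Bochner_Integration.integrable_add integrable_mult_right integrable_const int1 int2)
  have "(\<integral>h. contraction_bound \<eta> s p (hits K h) \<partial>coins K) = (s - 2 * \<eta> * p + 2 * \<eta>\<^sup>2 * L\<^sup>2 * s)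
      + 2 * \<eta> * (p - margin \<eta> * s) * 1 + 12 * \<eta>\<^sup>2 * L\<^sup>2 * s * (\<integral>h. (hits K h)\<^sup>2 \<partial>coins K)"
    unfolding eq using integral_hits[OF K] prob_space int1 int2 by simp
  also have "\<dots> \<le> (s - 2 * \<eta> * p + 2 * \<eta>\<^sup>2 * L\<^sup>2 * s)
      + 2 * \<eta> * (p - margin \<eta> * s) * 1 + 12 * \<eta>\<^sup>2 * L\<^sup>2 * s * 2"
    using s by (intro add_left_mono mult_left_mono integral_hits_square K) auto
  also have "\<dots> = (1 - 2 * \<eta> * m) * s + 34 * (\<eta> * L\<^sup>2) * (\<eta> * s)"
    by (simp add: power2_eq_square algebra_simps)
  also have "\<dots> \<le> (1 - 2 * \<eta> * m) * s + 34 * (m / 100) * (\<eta> * s)"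
    using \<eta> s by (intro add_left_mono mult_right_mono mult_left_mono) auto
  also have "\<dots> = (1 - 2 * \<eta> * m) * s + 34 / 100 * (\<eta> * m * s)"
    by simp
  also have "\<dots> \<le> (1 - 3 / 2 * \<eta> * m) * s"
  proof -
    have "0 \<le> \<eta> * m * s" using \<eta> m s by simp
    then show ?thesis by (simp add: algebra_simps)
  qed
  finally show ?B .
qed

end

section \<open>Measurability and integration against the noise\<close>

lemma measurable_Rd_restrict:
  "(\<And>j. j < d \<Longrightarrow> (\<lambda>z. f z j) \<in> borel_measurable N) \<Longrightarrow> (\<lambda>z. \<lambda>j\<in>{..<d}. f z j) \<in> N \<rightarrow>\<^sub>M Rd d"
  unfolding Rd_def by (intro measurable_restrict) auto

lemma measurable_Rd_component:
  "f \<in> N \<rightarrow>\<^sub>M Rd d \<Longrightarrow> j < d \<Longrightarrow> (\<lambda>z. f z j) \<in> borel_measurable N"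
  unfolding Rd_def by (rule measurable_compose[OF _ measurable_component_singleton]) auto

lemma measurable_inner_Rd:
  "f \<in> N \<rightarrow>\<^sub>M Rd d \<Longrightarrow> g \<in> N \<rightarrow>\<^sub>M Rd d \<Longrightarrow> (\<lambda>z. inner_Rd d (f z) (g z)) \<in> borel_measurable N"
  unfolding inner_Rd_def
  by (intro borel_measurable_sum borel_measurable_times measurable_Rd_component) auto

lemma measurable_diff_Rd:
  "f \<in> N \<rightarrow>\<^sub>M Rd d \<Longrightarrow> g \<in> N \<rightarrow>\<^sub>M Rd d \<Longrightarrow> (\<lambda>z. diff_Rd d (f z) (g z)) \<in> N \<rightarrow>\<^sub>M Rd d"
  unfolding diff_Rd_def
  by (intro measurable_Rd_restrict borel_measurable_diff measurable_Rd_component) auto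

lemma measurable_norm_Rd:
  "f \<in> N \<rightarrow>\<^sub>M Rd d \<Longrightarrow> (\<lambda>z. norm_Rd d (f z)) \<in> borel_measurable N"
  unfolding norm_Rd_def by (rule measurable_compose[where g = sqrt, OF measurable_inner_Rd]) auto

abbreviation gausses :: "nat \<Rightarrow> nat \<Rightarrow> (nat \<Rightarrow> rvec) measure" where
  "gausses d K \<equiv> Pi\<^sub>M {..<K} (\<lambda>_. std_gauss d)"

lemma prob_space_gausses: "prob_space (gausses d K)"
  by (intro prob_space_PiM prob_space_std_gauss)

lemma measurable_gausses_component:
  assumes "f \<in> N \<rightarrow>\<^sub>M gausses d K" "i < K"
  shows "(\<lambda>z. f z i) \<in> N \<rightarrow>\<^sub>M Rd d"
proof -
  have "(\<lambda>z. f z i) \<in> N \<rightarrow>\<^sub>M std_gauss d"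
    using assms by (intro measurable_compose[OF assms(1) measurable_component_singleton]) auto
  then show ?thesis by (simp cong: measurable_cong_sets)
qed

lemma prob_space_pair:
  assumes "prob_space M" "prob_space N"
  shows "prob_space (M \<Otimes>\<^sub>M N)"
proof -
  interpret M: prob_space M by fact
  interpret N: prob_space N by fact
  interpret pair_prob_space M N ..
  show ?thesis by unfold_locales
qed

lemma prob_space_prlmc_noise: "prob_space (prlmc_noise d K)"
  unfolding prlmc_noise_def
  by (intro prob_space_pair prob_space_coins prob_space_std_gauss prob_space_gausses)

text \<open>
  The Gaussian \<open>\<xi>\<close> of the new state is integrated first, with coins and midpoints held fixed; both
  the smoothing and the second moment are computed conditionally in this way.
\<close>

lemma nn_integral_prlmc_noise:
  assumes f: "f \<in> borel_measurable (prlmc_noise d K)"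
  shows "(\<integral>\<^sup>+z. f z \<partial>prlmc_noise d K)
    = (\<integral>\<^sup>+r. \<integral>\<^sup>+\<xi>. f (fst r, \<xi>, snd r) \<partial>std_gauss d \<partial>(coins K \<Otimes>\<^sub>M gausses d K))"
proof -
  interpret H: prob_space "coins K" by (rule prob_space_coins)
  interpret G: prob_space "std_gauss d" by (rule prob_space_std_gauss)
  interpret Z: prob_space "gausses d K" by (rule prob_space_gausses)
  interpret GZ: pair_prob_space "std_gauss d" "gausses d K" ..
  have [measurable]: "f \<in> borel_measurable (coins K \<Otimes>\<^sub>M (std_gauss d \<Otimes>\<^sub>M gausses d K))"
    using f by (simp add: prlmc_noise_def)
  have "(\<integral>\<^sup>+z. f z \<partial>prlmc_noise d K)
      = (\<integral>\<^sup>+h. \<integral>\<^sup>+p. f (h, p) \<partial>(std_gauss d \<Otimes>\<^sub>M gausses d K) \<partial>coins K)"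
    unfolding prlmc_noise_def by (rule GZ.nn_integral_fst[symmetric]) measurable
  also have "\<dots> = (\<integral>\<^sup>+h. \<integral>\<^sup>+\<zeta>. \<integral>\<^sup>+\<xi>. f (h, \<xi>, \<zeta>) \<partial>std_gauss d \<partial>gausses d K \<partial>coins K)"
    by (intro nn_integral_cong GZ.nn_integral_snd[symmetric]) measurable
  also have "\<dots> = (\<integral>\<^sup>+r. \<integral>\<^sup>+\<xi>. f (fst r, \<xi>, snd r) \<partial>std_gauss d \<partial>(coins K \<Otimes>\<^sub>M gausses d K))"
    by (subst Z.nn_integral_fst[symmetric]) auto
  finally show ?thesis .
qed

context strongly_convex_smooth
begin

lemma measurable_mid:
  assumes "f \<in> N \<rightarrow>\<^sub>M Rd d" "g \<in> N \<rightarrow>\<^sub>M Rd d"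
  shows "(\<lambda>z. prlmc_mid d K U \<eta> i (f z) (g z)) \<in> N \<rightarrow>\<^sub>M Rd d"
  unfolding prlmc_mid_def using assms
  by (intro measurable_Rd_restrict borel_measurable_add borel_measurable_diff borel_measurable_times
      borel_measurable_const measurable_grad measurable_Rd_component[of _ N d]) auto

lemma measurable_drift:
  assumes x: "x \<in> N \<rightarrow>\<^sub>M Rd d" and h: "h \<in> N \<rightarrow>\<^sub>M coins K" and \<zeta>: "\<zeta> \<in> N \<rightarrow>\<^sub>M gausses d K"
  shows "(\<lambda>z. drift K \<eta> (x z) (h z) (\<zeta> z)) \<in> N \<rightarrow>\<^sub>M Rd d"
  unfolding drift_def
proof (rule measurable_Rd_restrict)
  fix j assume j: "j < d"
  have [measurable]: "(\<lambda>z. x z j) \<in> borel_measurable N"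
    by (rule measurable_Rd_component[OF x j])
  have [measurable]: "(\<lambda>z. grad d U (x z) j) \<in> borel_measurable N"
    by (rule measurable_grad[OF x j])
  have [measurable]: "(\<lambda>z. of_bool (h z i) * (grad d U (x z) j -
      grad d U (prlmc_mid d K U \<eta> i (x z) (\<zeta> z i)) j)) \<in> borel_measurable N" if "i \<in> {..<K}" for i
    using that j by (intro borel_measurable_times borel_measurable_diff measurable_coin[OF h]
        measurable_grad measurable_mid x measurable_gausses_component[OF \<zeta>]) auto
  show "(\<lambda>z. x z j - \<eta> * grad d U (x z) j + \<eta> * (\<Sum>i<K. of_bool (h z i) * (grad d U (x z) j -
      grad d U (prlmc_mid d K U \<eta> i (x z) (\<zeta> z i)) j))) \<in> borel_measurable N"
    by measurable
qed

lemma measurable_prlmc_step: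
  "(\<lambda>p. prlmc_step d K U \<eta> (fst p) (snd p)) \<in> Rd d \<Otimes>\<^sub>M prlmc_noise d K \<rightarrow>\<^sub>M Rd d"
proof -
  let ?N = "Rd d \<Otimes>\<^sub>M prlmc_noise d K"
  have h: "(\<lambda>p. fst (snd p)) \<in> ?N \<rightarrow>\<^sub>M coins K"
    and \<xi>: "(\<lambda>p. fst (snd (snd p))) \<in> ?N \<rightarrow>\<^sub>M Rd d"
    and \<zeta>: "(\<lambda>p. snd (snd (snd p))) \<in> ?N \<rightarrow>\<^sub>M gausses d K"
    unfolding prlmc_noise_def by measurable
  have "(\<lambda>p. \<lambda>j\<in>{..<d}. drift K \<eta> (fst p) (fst (snd p)) (snd (snd (snd p))) j
      + sqrt (2 * \<eta>) * fst (snd (snd p)) j) \<in> ?N \<rightarrow>\<^sub>M Rd d"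
    by (intro measurable_Rd_restrict borel_measurable_add borel_measurable_times borel_measurable_const
        measurable_Rd_component[OF \<xi>] measurable_Rd_component[OF measurable_drift] measurable_fst h \<zeta>)
  then show ?thesis
    by (simp add: prlmc_step_eq[symmetric])
qed

lemma prlmc_step_measurable:
  assumes "x \<in> space (Rd d)"
  shows "prlmc_step d K U \<eta> x \<in> prlmc_noise d K \<rightarrow>\<^sub>M Rd d"
  using measurable_compose[OF measurable_Pair[OF measurable_const[OF assms] measurable_ident] measurable_prlmc_step]
  by simp

end

text \<open>
  The pathwise contraction bound depends on the noise through the coins alone, so its expectation is
  one over the coins.
\<close>

lemma integrable_prlmc_noise_coins:
  fixes g :: "(nat \<Rightarrow> bool) \<Rightarrow> real"
  assumes g: "integrable (coins K) g"
  shows "integrable (prlmc_noise d K) (\<lambda>z. g (fst z))"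
    and "(\<integral>z. g (fst z) \<partial>prlmc_noise d K) = (\<integral>h. g h \<partial>coins K)"
proof -
  let ?R = "std_gauss d \<Otimes>\<^sub>M gausses d K"
  interpret R: prob_space ?R
    by (intro prob_space_pair prob_space_std_gauss prob_space_gausses)
  have distr: "distr (prlmc_noise d K) (coins K) fst = coins K"
    unfolding prlmc_noise_def by (rule R.distr_pair_fst)
  have fst: "fst \<in> prlmc_noise d K \<rightarrow>\<^sub>M coins K"
    unfolding prlmc_noise_def by simp
  show "integrable (prlmc_noise d K) (\<lambda>z. g (fst z))"
    using integrable_distr_eq[OF fst, of g] g by (simp add: distr)
  show "(\<integral>z. g (fst z) \<partial>prlmc_noise d K) = (\<integral>h. g h \<partial>coins K)"
    using integral_distr[OF fst, of g] g by (simp add: distr)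
qed

lemma (in prob_space) expectation_square_le:
  fixes X :: "'a \<Rightarrow> real"
  assumes "integrable M X" "integrable M (\<lambda>x. (X x)\<^sup>2)"
  shows "(expectation X)\<^sup>2 \<le> expectation (\<lambda>x. (X x)\<^sup>2)"
  using variance_positive[of X] by (simp add: variance_eq[OF assms])

lemma norm_Rd_le: "norm_Rd d x \<le> 1 + sq d x"
proof -
  have "0 \<le> (norm_Rd d x - 1)\<^sup>2" by simp
  then have "2 * norm_Rd d x \<le> 1 + sq d x"
    by (simp add: power2_diff)
  then show ?thesis using norm_Rd_nonneg[of d x] by linarith
qed

lemma zero_vec_apply: "j < d \<Longrightarrow> zero_vec d j = 0"
  by (simp add: zero_vec_def)

lemma nn_integral_gausses_sq:
  assumes i: "i < K"
  shows "(\<integral>\<^sup>+\<zeta>. ennreal (sq d (\<zeta> i)) \<partial>gausses d K) = ennreal (real d)"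
proof -
  have m: "(\<lambda>\<xi>. ennreal (sq d \<xi>)) \<in> borel_measurable (std_gauss d)"
    by (intro measurable_compose[OF measurable_inner_Rd[of _ _ d] measurable_ennreal]) (simp_all cong: measurable_cong_sets)
  have "(\<integral>\<^sup>+\<zeta>. ennreal (sq d (\<zeta> i)) \<partial>gausses d K)
      = (\<integral>\<^sup>+\<xi>. ennreal (sq d \<xi>) \<partial>distr (gausses d K) (std_gauss d) (\<lambda>\<zeta>. \<zeta> i))"
    by (subst nn_integral_distr) (use i m in auto)
  also have "distr (gausses d K) (std_gauss d) (\<lambda>\<zeta>. \<zeta> i) = std_gauss d"
    using i by (intro distr_PiM_component prob_space_std_gauss) auto
  also have "(\<integral>\<^sup>+\<xi>. ennreal (sq d \<xi>) \<partial>std_gauss d) = ennreal (real d)"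
    using nn_integral_std_gauss_affine[of d "\<lambda>_. 0" 1] by (simp add: inner_Rd_def power2_eq_square)
  finally show ?thesis .
qed

section \<open>Contraction, drift and smoothing of the chain\<close>

text \<open>
  The constant \<open>100\<close> leaves enough room for the error terms of second order in
  \<open>\<eta>\<close> to be dominated by fractions of \<open>\<eta> m\<close>.
\<close>

locale prlmc = strongly_convex_smooth +
  fixes K :: nat and \<eta> :: real
  assumes K: "1 \<le> K" and \<eta>: "0 < \<eta>" and small: "\<eta> * (100 * L\<^sup>2) \<le> m"
begin

abbreviation "noise \<equiv> prlmc_noise d K"
abbreviation "step \<equiv> prlmc_step d K U \<eta>"
abbreviation "dist_Rd x y \<equiv> norm_Rd d (diff_Rd d x y)"

lemma \<eta>L2: "\<eta> * L\<^sup>2 \<le> m / 100"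
  using small by simp

lemma \<eta>L: "\<eta> * L \<le> 1 / 100"
proof -
  have "\<eta> * L * (100 * L) \<le> 1 * L"
    using small mL by (simp add: power2_eq_square mult_ac)
  then show ?thesis using L by simp
qed

lemma \<eta>m: "0 < \<eta> * m" "\<eta> * m \<le> 1 / 100"
proof -
  show "0 < \<eta> * m" using \<eta> m by simp
  have "\<eta> * m \<le> \<eta> * L" using mL \<eta> by (intro mult_left_mono) auto
  then show "\<eta> * m \<le> 1 / 100" using \<eta>L by linarith
qed

abbreviation "\<rho> \<equiv> sqrt (1 - 3 / 2 * \<eta> * m)"

lemma \<rho>: "0 < \<rho>" "\<rho> < 1"
  using \<eta>m by simp_all

text \<open>
  The Gaussian \<open>\<xi>\<close> is common to both copies and drops out of the difference.
\<close>

lemma step_difference: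
  "sq d (diff_Rd d (step x z) (step y z))
    = sq d (diff_Rd d (drift K \<eta> x (fst z) (snd (snd z))) (drift K \<eta> y (fst z) (snd (snd z))))"
proof (cases z)
  case (fields h \<xi> \<zeta>)
  then show ?thesis by (auto simp: prlmc_step_eq intro!: inner_Rd_cong)
qed

text \<open>
  A pathwise bound with a constant depending on \<open>K\<close>.  It serves for the smoothing estimate, whose
  constant does not affect the exponential rate.
\<close>

lemma contraction_bound_le:
  assumes s: "0 \<le> s" and p: "m * s \<le> p" "p \<le> L * s" and n: "0 \<le> n" "n \<le> real K"
  shows "contraction_bound \<eta> s p n \<le> (1 + 2 * \<eta> * (real K * (L + 4 * \<eta> * L\<^sup>2)) +
    \<eta>\<^sup>2 * ((2 + 12 * (real K)\<^sup>2) * L\<^sup>2)) * s"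
proof -
  have p0: "0 \<le> p" using p(1) mult_nonneg_nonneg[of m s] m s by linarith
  have "p - margin \<eta> * s \<le> (L + 4 * \<eta> * L\<^sup>2) * s"
  proof -
    have "p - margin \<eta> * s = p - m * s + 4 * \<eta> * L\<^sup>2 * s" by (simp add: algebra_simps)
    also have "\<dots> \<le> L * s + 4 * \<eta> * L\<^sup>2 * s"
      using p mult_nonneg_nonneg[of m s] m s by linarith
    finally show ?thesis by (simp add: algebra_simps)
  qed
  moreover have "0 \<le> (L + 4 * \<eta> * L\<^sup>2) * s"
    using L \<eta> s by simp
  ultimately have "n * (p - margin \<eta> * s) \<le> real K * ((L + 4 * \<eta> * L\<^sup>2) * s)"
    using n by (meson mult_left_mono mult_right_mono order_trans)
  then have "2 * \<eta> * (n * (p - margin \<eta> * s) - p) \<le> 2 * \<eta> * (real K * ((L + 4 * \<eta> * L\<^sup>2) * s))"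
    using \<eta> p0 by (intro mult_left_mono) auto
  moreover have "\<eta>\<^sup>2 * ((2 + 12 * n\<^sup>2) * L\<^sup>2 * s) \<le> \<eta>\<^sup>2 * ((2 + 12 * (real K)\<^sup>2) * L\<^sup>2 * s)"
    using n s by (intro mult_left_mono mult_right_mono add_left_mono power_mono) auto
  ultimately show ?thesis
    unfolding contraction_bound_def by (simp add: algebra_simps)
qed

lemma measurable_sq_step:
  assumes x: "x \<in> space (Rd d)"
  shows "(\<lambda>z. sq d (step x z)) \<in> borel_measurable noise"
  by (intro measurable_inner_Rd prlmc_step_measurable x)

lemma
  assumes x: "x \<in> space (Rd d)" and y: "y \<in> space (Rd d)"
  shows integrable_sq_step: "integrable noise (\<lambda>z. sq d (diff_Rd d (step x z) (step y z)))"
    and integral_sq_step: "(\<integral>z. sq d (diff_Rd d (step x z) (step y z)) \<partial>noise)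
      \<le> (1 - 3 / 2 * \<eta> * m) * sq d (diff_Rd d x y)"
proof -
  let ?s = "sq d (diff_Rd d x y)"
  let ?p = "inner_Rd d (diff_Rd d x y) (diff_Rd d (grad d U x) (grad d U y))"
  let ?b = "\<lambda>h. contraction_bound \<eta> ?s ?p (hits K h)"
  have b: "integrable (coins K) ?b" "(\<integral>h. ?b h \<partial>coins K) \<le> (1 - 3 / 2 * \<eta> * m) * ?s"
    by (rule integrable_contraction_bound integral_contraction_bound; use \<eta> \<eta>L2 K in simp)+
  have le: "sq d (diff_Rd d (step x z) (step y z)) \<le> ?b (fst z)" for z
    unfolding step_difference by (rule drift_difference_bound[OF \<eta> \<eta>L x y])
  show int: "integrable noise (\<lambda>z. sq d (diff_Rd d (step x z) (step y z)))"
  proof (rule Bochner_Integration.integrable_bound[OF integrable_prlmc_noise_coins(1)[OF b(1), of d]])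
    show "(\<lambda>z. sq d (diff_Rd d (step x z) (step y z))) \<in> borel_measurable noise"
      by (intro measurable_inner_Rd measurable_diff_Rd prlmc_step_measurable x y)
    show "AE z in noise. norm (sq d (diff_Rd d (step x z) (step y z))) \<le> norm (?b (fst z))"
      using le by (intro AE_I2) (auto intro: order_trans[OF le abs_ge_self])
  qed
  have "(\<integral>z. sq d (diff_Rd d (step x z) (step y z)) \<partial>noise) \<le> (\<integral>z. ?b (fst z) \<partial>noise)"
    by (intro integral_mono int integrable_prlmc_noise_coins b le)
  also have "\<dots> \<le> (1 - 3 / 2 * \<eta> * m) * ?s"
    using b(2) integrable_prlmc_noise_coins(2)[OF b(1)] by simp
  finally show "(\<integral>z. sq d (diff_Rd d (step x z) (step y z)) \<partial>noise) \<le> (1 - 3 / 2 * \<eta> * m) * ?s" .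
qed

lemma integrable_dist_step:
  assumes x: "x \<in> space (Rd d)" and y: "y \<in> space (Rd d)"
  shows "integrable noise (\<lambda>z. dist_Rd (step x z) (step y z))"
proof -
  interpret prob_space noise by (rule prob_space_prlmc_noise)
  show ?thesis
  proof (rule Bochner_Integration.integrable_bound)
    show "integrable noise (\<lambda>z. 1 + sq d (diff_Rd d (step x z) (step y z)))"
      by (intro Bochner_Integration.integrable_add integrable_const integrable_sq_step x y)
    show "(\<lambda>z. dist_Rd (step x z) (step y z)) \<in> borel_measurable noise"
      by (intro measurable_norm_Rd measurable_diff_Rd prlmc_step_measurable x y)
    show "AE z in noise. norm (dist_Rd (step x z) (step y z))
        \<le> norm (1 + sq d (diff_Rd d (step x z) (step y z)))"
      using norm_Rd_le by (intro AE_I2) simp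
  qed
qed

text \<open>
  Jensen's inequality passes from the mean square of the distance to its mean.
\<close>

lemma step_contraction:
  assumes x: "x \<in> space (Rd d)" and y: "y \<in> space (Rd d)"
  shows "(\<integral>z. dist_Rd (step x z) (step y z) \<partial>noise) \<le> \<rho> * dist_Rd x y"
proof -
  interpret prob_space noise by (rule prob_space_prlmc_noise)
  have "(\<integral>z. dist_Rd (step x z) (step y z) \<partial>noise)\<^sup>2
      \<le> (\<integral>z. (dist_Rd (step x z) (step y z))\<^sup>2 \<partial>noise)"
    by (rule expectation_square_le) (simp_all add: integrable_dist_step integrable_sq_step x y)
  also have "\<dots> \<le> (1 - 3 / 2 * \<eta> * m) * sq d (diff_Rd d x y)"
    using integral_sq_step[OF x y] by simp
  also have "\<dots> = (\<rho> * dist_Rd x y)\<^sup>2"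
    using \<eta>m by (simp add: power_mult_distrib)
  finally show ?thesis
    by (rule power2_le_imp_le) (use \<rho> in simp)
qed

text \<open>
  At the minimiser only the gradients at activated midpoints remain, and these are of order
  \<open>sqrt \<eta>\<close>; after multiplication by \<open>\<eta>\<close> the square is of order \<open>\<eta>\<^sup>3\<close>.
\<close>

lemma sq_drift_zero_le:
  "sq d (drift K \<eta> (zero_vec d) h \<zeta>)
    \<le> 2 * \<eta> ^ 3 * L\<^sup>2 * (hits K h * (\<Sum>i<K. of_bool (h i) * sq d (\<zeta> i)))"
proof -
  let ?g = "\<lambda>i. grad d U (prlmc_mid d K U \<eta> i (zero_vec d) (\<zeta> i))"
  have g: "sq d (?g i) \<le> 2 * \<eta> * L\<^sup>2 * sq d (\<zeta> i)" if i: "i < K" for i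
  proof -
    have "sq d (prlmc_mid d K U \<eta> i (zero_vec d) (\<zeta> i)) = (sqrt (2 * real i * \<eta> / real K))\<^sup>2 * sq d (\<zeta> i)"
      using sq_lincomb[of d "prlmc_mid d K U \<eta> i (zero_vec d) (\<zeta> i)" "sqrt (2 * real i * \<eta> / real K)" "\<zeta> i" 0 "\<zeta> i"]
      by (simp add: prlmc_mid_def grad_zero zero_vec_apply)
    also have "(sqrt (2 * real i * \<eta> / real K))\<^sup>2 = 2 * real i * \<eta> / real K"
      using \<eta> by (intro real_sqrt_pow2) simp
    also have "2 * real i * \<eta> / real K * sq d (\<zeta> i) \<le> 2 * \<eta> * sq d (\<zeta> i)"
      using i \<eta> by (intro mult_right_mono) (auto simp: field_simps)
    finally have "sq d (prlmc_mid d K U \<eta> i (zero_vec d) (\<zeta> i)) \<le> 2 * \<eta> * sq d (\<zeta> i)" .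
    then have "L\<^sup>2 * sq d (prlmc_mid d K U \<eta> i (zero_vec d) (\<zeta> i)) \<le> L\<^sup>2 * (2 * \<eta> * sq d (\<zeta> i))"
      by (intro mult_left_mono) auto
    with sq_grad_le[of "prlmc_mid d K U \<eta> i (zero_vec d) (\<zeta> i)"] show ?thesis by (simp add: mult_ac)
  qed
  define S where "S j = (\<Sum>i<K. of_bool (h i) * ?g i j)" for j
  have "drift K \<eta> (zero_vec d) h \<zeta> j = - \<eta> * S j + 0 * S j" if "j < d" for j
    using that by (simp add: drift_def S_def grad_zero zero_vec_apply sum_negf)
  then have "sq d (drift K \<eta> (zero_vec d) h \<zeta>) = \<eta>\<^sup>2 * sq d S"
    using sq_lincomb[of d "drift K \<eta> (zero_vec d) h \<zeta>" "- \<eta>" S 0 S] by simp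
  also have "\<dots> \<le> \<eta>\<^sup>2 * (hits K h * (\<Sum>i<K. of_bool (h i) * sq d (?g i)))"
    unfolding S_def by (intro mult_left_mono sq_coin_sum_le) simp
  also have "\<dots> \<le> \<eta>\<^sup>2 * (hits K h * (\<Sum>i<K. of_bool (h i) * (2 * \<eta> * L\<^sup>2 * sq d (\<zeta> i))))"
    by (intro mult_left_mono sum_mono g) auto
  also have "\<dots> = 2 * \<eta> ^ 3 * L\<^sup>2 * (hits K h * (\<Sum>i<K. of_bool (h i) * sq d (\<zeta> i)))"
    unfolding sum_distrib_left by (intro sum.cong) (simp_all add: power2_eq_square power3_eq_cube mult_ac)
  finally show ?thesis .
qed

text \<open>
  The step from \<open>x\<close> is compared with the step from the minimiser under the same noise; \<open>\<alpha>\<close> is the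
  weight in Young's inequality.
\<close>

lemma sq_drift_le:
  assumes x: "x \<in> space (Rd d)" and \<alpha>: "0 < \<alpha>"
  defines "p \<equiv> inner_Rd d (diff_Rd d x (zero_vec d)) (diff_Rd d (grad d U x) (grad d U (zero_vec d)))"
  shows "sq d (drift K \<eta> x h \<zeta>) \<le> (1 + \<alpha>) * contraction_bound \<eta> (sq d x) p (hits K h)
    + (1 + 1 / \<alpha>) * (2 * \<eta> ^ 3 * L\<^sup>2 * (hits K h * (\<Sum>i<K. of_bool (h i) * sq d (\<zeta> i))))"
    and "0 \<le> contraction_bound \<eta> (sq d x) p (hits K h)"
proof -
  let ?a = "diff_Rd d (drift K \<eta> x h \<zeta>) (drift K \<eta> (zero_vec d) h \<zeta>)"
  let ?b = "drift K \<eta> (zero_vec d) h \<zeta>"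
  have x0: "sq d (diff_Rd d x (zero_vec d)) = sq d x"
    by (intro inner_Rd_cong) (simp_all add: zero_vec_def)
  have a: "sq d ?a \<le> contraction_bound \<eta> (sq d x) p (hits K h)"
    using drift_difference_bound[OF \<eta> \<eta>L x zero_in_space, where K = K and h = h and \<zeta> = \<zeta>]
    by (simp add: x0 p_def)
  show "0 \<le> contraction_bound \<eta> (sq d x) p (hits K h)"
    using a sq_nonneg[of d ?a] by linarith
  have "sq d (drift K \<eta> x h \<zeta>) = sq d ?a + 2 * inner_Rd d ?a ?b + sq d ?b"
    using sq_lincomb[of d "drift K \<eta> x h \<zeta>" 1 ?a 1 ?b] by simp
  also have "\<dots> \<le> (1 + \<alpha>) * sq d ?a + (1 + 1 / \<alpha>) * sq d ?b"
    using Young[OF \<alpha>, of d ?a ?b] by (simp add: algebra_simps)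
  also have "\<dots> \<le> (1 + \<alpha>) * contraction_bound \<eta> (sq d x) p (hits K h)
    + (1 + 1 / \<alpha>) * (2 * \<eta> ^ 3 * L\<^sup>2 * (hits K h * (\<Sum>i<K. of_bool (h i) * sq d (\<zeta> i))))"
    using \<alpha> by (intro add_mono mult_left_mono a sq_drift_zero_le) auto
  finally show "sq d (drift K \<eta> x h \<zeta>) \<le> (1 + \<alpha>) * contraction_bound \<eta> (sq d x) p (hits K h)
    + (1 + 1 / \<alpha>) * (2 * \<eta> ^ 3 * L\<^sup>2 * (hits K h * (\<Sum>i<K. of_bool (h i) * sq d (\<zeta> i))))" .
qed

end

context prlmc
begin

lemma nn_integral_weighted_sq_sum:
  assumes A: "0 \<le> A" and B: "0 \<le> B"
  shows "(\<integral>\<^sup>+\<zeta>. ennreal (A + B * (\<Sum>i<K. of_bool (h i) * sq d (\<zeta> i))) \<partial>gausses d K)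
    = ennreal (A + B * (hits K h * real d))"
proof -
  interpret Z: prob_space "gausses d K" by (rule prob_space_gausses)
  have m: "(\<lambda>\<zeta>. ennreal (sq d (\<zeta> i))) \<in> borel_measurable (gausses d K)" if "i < K" for i
    using that
    by (intro measurable_compose[OF measurable_inner_Rd measurable_ennreal] measurable_gausses_component) auto
  have "(\<integral>\<^sup>+\<zeta>. ennreal (A + B * (\<Sum>i<K. of_bool (h i) * sq d (\<zeta> i))) \<partial>gausses d K)
      = (\<integral>\<^sup>+\<zeta>. ennreal A + (\<Sum>i<K. ennreal (B * of_bool (h i)) * ennreal (sq d (\<zeta> i))) \<partial>gausses d K)"
  proof (rule nn_integral_cong)
    fix \<zeta> :: "nat \<Rightarrow> rvec"
    have "B * (\<Sum>i<K. of_bool (h i) * sq d (\<zeta> i)) = (\<Sum>i<K. B * of_bool (h i) * sq d (\<zeta> i))"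
      by (simp only: sum_distrib_left mult.assoc)
    then have "ennreal (A + B * (\<Sum>i<K. of_bool (h i) * sq d (\<zeta> i)))
        = ennreal (A + (\<Sum>i<K. B * of_bool (h i) * sq d (\<zeta> i)))"
      by (simp only:)
    also have "\<dots> = ennreal A + ennreal (\<Sum>i<K. B * of_bool (h i) * sq d (\<zeta> i))"
      using A B by (intro ennreal_plus sum_nonneg mult_nonneg_nonneg) auto
    also have "ennreal (\<Sum>i<K. B * of_bool (h i) * sq d (\<zeta> i))
        = (\<Sum>i<K. ennreal (B * of_bool (h i) * sq d (\<zeta> i)))"
      using B by (intro sum_ennreal[symmetric] mult_nonneg_nonneg) auto
    also have "\<dots> = (\<Sum>i<K. ennreal (B * of_bool (h i)) * ennreal (sq d (\<zeta> i)))"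
      using B by (intro sum.cong ennreal_mult mult_nonneg_nonneg) auto
    finally show "ennreal (A + B * (\<Sum>i<K. of_bool (h i) * sq d (\<zeta> i)))
        = ennreal A + (\<Sum>i<K. ennreal (B * of_bool (h i)) * ennreal (sq d (\<zeta> i)))" .
  qed
  also have "\<dots> = ennreal A + (\<integral>\<^sup>+\<zeta>. (\<Sum>i<K. ennreal (B * of_bool (h i)) * ennreal (sq d (\<zeta> i))) \<partial>gausses d K)"
    using m Z.emeasure_space_1
    by (subst nn_integral_add) (auto intro!: borel_measurable_sum borel_measurable_times_ennreal)
  also have "(\<integral>\<^sup>+\<zeta>. (\<Sum>i<K. ennreal (B * of_bool (h i)) * ennreal (sq d (\<zeta> i))) \<partial>gausses d K)
      = (\<Sum>i<K. \<integral>\<^sup>+\<zeta>. ennreal (B * of_bool (h i)) * ennreal (sq d (\<zeta> i)) \<partial>gausses d K)"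
    using m by (intro nn_integral_sum borel_measurable_times_ennreal) auto
  also have "\<dots> = (\<Sum>i<K. ennreal (B * of_bool (h i)) * ennreal (real d))"
    using m by (intro sum.cong) (auto simp: nn_integral_cmult nn_integral_gausses_sq)
  also have "\<dots> = (\<Sum>i<K. ennreal (B * of_bool (h i) * real d))"
    using B by (intro sum.cong ennreal_mult[symmetric] mult_nonneg_nonneg) auto
  also have "\<dots> = ennreal (\<Sum>i<K. B * of_bool (h i) * real d)"
    using B by (intro sum_ennreal mult_nonneg_nonneg) auto
  also have "(\<Sum>i<K. B * of_bool (h i) * real d) = B * (hits K h * real d)"
    unfolding hits_def sum_distrib_right sum_distrib_left by (simp add: mult_ac)
  also have "ennreal A + ennreal (B * (hits K h * real d)) = ennreal (A + B * (hits K h * real d))"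
    using A B by simp
  finally show ?thesis .
qed

text \<open>
  Conditionally on coins and midpoints, the final Gaussian contributes exactly \<open>2 \<eta> d\<close>.  With weight
  \<open>\<alpha> = \<eta> m / 4\<close> in Young's inequality, the contraction factor \<open>1 - 3/2 \<eta> m\<close> degrades to at most
  \<open>1 - 5/4 \<eta> m\<close>, while the contribution of order \<open>\<eta>\<^sup>3 / \<alpha>\<close> from the step at the minimiser is
  at most \<open>\<eta> d / 5\<close>.
\<close>

lemma second_moment_step:
  assumes x: "x \<in> space (Rd d)"
  shows "(\<integral>\<^sup>+z. ennreal (sq d (step x z)) \<partial>noise)
    \<le> ennreal (1 - 5 / 4 * (\<eta> * m)) * ennreal (sq d x) + ennreal (11 / 5 * \<eta> * real d)"
proof -
  interpret H: prob_space "coins K" by (rule prob_space_coins)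
  interpret Z: prob_space "gausses d K" by (rule prob_space_gausses)
  define \<alpha> where "\<alpha> = \<eta> * m / 4"
  \<comment> \<open>the weight of the step from the minimiser: Young's factor times the constant in \<open>sq_drift_zero_le\<close>\<close>
  define c where "c = (1 + 1 / \<alpha>) * (2 * \<eta> ^ 3 * L\<^sup>2)"
  define p where "p = inner_Rd d (diff_Rd d x (zero_vec d)) (diff_Rd d (grad d U x) (grad d U (zero_vec d)))"
  define b where "b h = contraction_bound \<eta> (sq d x) p (hits K h)" for h
  have \<alpha>: "0 < \<alpha>" using \<eta>m by (simp add: \<alpha>_def)
  have c: "0 \<le> c" using \<alpha> \<eta> by (simp add: c_def)
  have b0: "0 \<le> b h" for h
    unfolding b_def p_def by (rule sq_drift_le(2)[OF x \<alpha>])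
  have b: "integrable (coins K) b" "(\<integral>h. b h \<partial>coins K) \<le> (1 - 3 / 2 * \<eta> * m) * sq d x"
    unfolding b_def by (rule integrable_contraction_bound integral_contraction_bound; use \<eta> \<eta>L2 K in simp)+
  have hits2: "integrable (coins K) (\<lambda>h. (hits K h)\<^sup>2)"
    by (rule integrable_coins_bounded[of _ _ "(real K)\<^sup>2"]) (auto simp: hits_le power_mono)
  have meas: "(\<lambda>z. ennreal (sq d (step x z))) \<in> borel_measurable noise"
    by (rule measurable_compose[OF measurable_sq_step[OF x] measurable_ennreal])
  have "(\<integral>\<^sup>+z. ennreal (sq d (step x z)) \<partial>noise)
      = (\<integral>\<^sup>+r. \<integral>\<^sup>+\<xi>. ennreal (sq d (step x (fst r, \<xi>, snd r))) \<partial>std_gauss d \<partial>(coins K \<Otimes>\<^sub>M gausses d K))"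
    by (rule nn_integral_prlmc_noise[OF meas])
  also have "\<dots> = (\<integral>\<^sup>+r. ennreal (sq d (drift K \<eta> x (fst r) (snd r)) + 2 * \<eta> * real d)
      \<partial>(coins K \<Otimes>\<^sub>M gausses d K))"
  proof (rule nn_integral_cong)
    fix r :: "(nat \<Rightarrow> bool) \<times> (nat \<Rightarrow> rvec)"
    have sqrt2: "(sqrt (2 * \<eta>))\<^sup>2 = 2 * \<eta>" using \<eta> by simp
    have sq_sum: "sq d v = (\<Sum>j<d. (v j)\<^sup>2)" for v
      by (simp add: inner_Rd_def power2_eq_square)
    have "sq d (step x (fst r, \<xi>, snd r))
        = (\<Sum>j<d. (drift K \<eta> x (fst r) (snd r) j + sqrt (2 * \<eta>) * \<xi> j)\<^sup>2)" for \<xi>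
      unfolding sq_sum by (simp add: prlmc_step_eq)
    then show "(\<integral>\<^sup>+\<xi>. ennreal (sq d (step x (fst r, \<xi>, snd r))) \<partial>std_gauss d)
        = ennreal (sq d (drift K \<eta> x (fst r) (snd r)) + 2 * \<eta> * real d)"
      by (simp only: nn_integral_std_gauss_affine sqrt2 sq_sum mult.commute[of "real d"])
  qed
  also have "\<dots> = (\<integral>\<^sup>+h. \<integral>\<^sup>+\<zeta>. ennreal (sq d (drift K \<eta> x h \<zeta>) + 2 * \<eta> * real d) \<partial>gausses d K \<partial>coins K)"
  proof -
    have "(\<lambda>r. sq d (drift K \<eta> x (fst r) (snd r))) \<in> borel_measurable (coins K \<Otimes>\<^sub>M gausses d K)"
      using x by (intro measurable_inner_Rd measurable_drift) auto
    then show ?thesis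
      by (subst Z.nn_integral_fst[symmetric]) auto
  qed
  also have "\<dots> \<le> (\<integral>\<^sup>+h. \<integral>\<^sup>+\<zeta>. ennreal (((1 + \<alpha>) * b h + 2 * \<eta> * real d)
      + (c * hits K h) * (\<Sum>i<K. of_bool (h i) * sq d (\<zeta> i))) \<partial>gausses d K \<partial>coins K)"
  proof (intro nn_integral_mono ennreal_leI)
    fix h \<zeta>
    show "sq d (drift K \<eta> x h \<zeta>) + 2 * \<eta> * real d \<le> (1 + \<alpha>) * b h + 2 * \<eta> * real d
        + c * hits K h * (\<Sum>i<K. of_bool (h i) * sq d (\<zeta> i))"
      using sq_drift_le(1)[OF x \<alpha>, of h \<zeta>] unfolding b_def[symmetric] p_def[symmetric] c_def
      by (simp only: mult.assoc)
  qed
  also have "\<dots> = (\<integral>\<^sup>+h. ennreal (((1 + \<alpha>) * b h + 2 * \<eta> * real d) + (c * hits K h) * (hits K h * real d)) \<partial>coins K)"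
    using \<alpha> \<eta> b0 c by (intro nn_integral_cong nn_integral_weighted_sq_sum add_nonneg_nonneg mult_nonneg_nonneg) auto
  also have "\<dots> = (\<integral>\<^sup>+h. ennreal ((1 + \<alpha>) * b h + 2 * \<eta> * real d + c * real d * (hits K h)\<^sup>2) \<partial>coins K)"
    by (simp add: power2_eq_square mult_ac)
  also have "\<dots> = ennreal (\<integral>h. (1 + \<alpha>) * b h + 2 * \<eta> * real d + c * real d * (hits K h)\<^sup>2 \<partial>coins K)"
    using \<alpha> \<eta> b0 c b(1) hits2
    by (intro nn_integral_eq_integral AE_I2 add_nonneg_nonneg mult_nonneg_nonneg
        Bochner_Integration.integrable_add integrable_mult_right H.integrable_const) auto
  also have "(\<integral>h. (1 + \<alpha>) * b h + 2 * \<eta> * real d + c * real d * (hits K h)\<^sup>2 \<partial>coins K)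
      = (1 + \<alpha>) * (\<integral>h. b h \<partial>coins K) + 2 * \<eta> * real d + c * real d * (\<integral>h. (hits K h)\<^sup>2 \<partial>coins K)"
    using b(1) hits2 H.prob_space by simp
  also have "ennreal \<dots> \<le> ennreal ((1 - 5 / 4 * (\<eta> * m)) * sq d x + 11 / 5 * \<eta> * real d)"
  proof (rule ennreal_leI)
    have "(1 + \<alpha>) * (\<integral>h. b h \<partial>coins K) \<le> (1 + \<alpha>) * ((1 - 3 / 2 * \<eta> * m) * sq d x)"
      using \<alpha> by (intro mult_left_mono b) auto
    also have "\<dots> = ((1 + \<alpha>) * (1 - 3 / 2 * \<eta> * m)) * sq d x" by simp
    also have "\<dots> \<le> (1 - 5 / 4 * (\<eta> * m)) * sq d x"
    proof (rule mult_right_mono)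
      have "(1 + \<alpha>) * (1 - 3 / 2 * \<eta> * m) = 1 - 5 / 4 * (\<eta> * m) - 3 / 8 * (\<eta> * m)\<^sup>2"
        by (simp add: \<alpha>_def power2_eq_square field_simps)
      then show "(1 + \<alpha>) * (1 - 3 / 2 * \<eta> * m) \<le> 1 - 5 / 4 * (\<eta> * m)" by simp
    qed simp
    finally have 1: "(1 + \<alpha>) * (\<integral>h. b h \<partial>coins K) \<le> (1 - 5 / 4 * (\<eta> * m)) * sq d x" .
    have "1 + 1 / \<alpha> \<le> 5 / (\<eta> * m)"
      using \<eta>m by (simp add: \<alpha>_def field_simps)
    then have "c \<le> 5 / (\<eta> * m) * (2 * \<eta> ^ 3 * L\<^sup>2)"
      unfolding c_def using \<eta> by (intro mult_right_mono) auto
    also have "\<dots> = 10 * \<eta> * (\<eta> * L\<^sup>2 / m)"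
      using \<eta> m by (simp add: power3_eq_cube field_simps)
    also have "\<dots> \<le> 10 * \<eta> * (1 / 100)"
      using \<eta> m \<eta>L2 by (intro mult_left_mono) (auto simp: field_simps)
    finally have "c * real d \<le> \<eta> / 10 * real d"
      by (intro mult_right_mono) auto
    from mult_mono[OF this integral_hits_square[OF K]]
    have "c * real d * (\<integral>h. (hits K h)\<^sup>2 \<partial>coins K) \<le> \<eta> / 10 * real d * 2"
      using \<eta> by simp
    with 1 show "(1 + \<alpha>) * (\<integral>h. b h \<partial>coins K) + 2 * \<eta> * real d + c * real d * (\<integral>h. (hits K h)\<^sup>2 \<partial>coins K)
        \<le> (1 - 5 / 4 * (\<eta> * m)) * sq d x + 11 / 5 * \<eta> * real d"
      by simp
  qed
  also have "\<dots> = ennreal (1 - 5 / 4 * (\<eta> * m)) * ennreal (sq d x) + ennreal (11 / 5 * \<eta> * real d)"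
    using \<eta> \<eta>m by (simp add: ennreal_mult)
  finally show ?thesis .
qed

lemma integrable_dist_displacement:
  assumes x: "x \<in> space (Rd d)"
  shows "integrable noise (\<lambda>z. dist_Rd x (step x z))"
proof -
  interpret prob_space noise by (rule prob_space_prlmc_noise)
  have "integrable noise (\<lambda>z. sq d (step x z))"
  proof (rule integrableI_nonneg[OF measurable_sq_step[OF x]])
    show "(\<integral>\<^sup>+z. ennreal (sq d (step x z)) \<partial>noise) < \<infinity>"
      using second_moment_step[OF x] by (rule le_less_trans) (simp add: ennreal_mult_less_top)
  qed simp
  then have int: "integrable noise (\<lambda>z. 1 + 2 * sq d x + 2 * sq d (step x z))"
    by (intro Bochner_Integration.integrable_add integrable_const integrable_mult_right) auto
  show ?thesis
  proof (rule Bochner_Integration.integrable_bound[OF int])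
    show "(\<lambda>z. dist_Rd x (step x z)) \<in> borel_measurable noise"
      using x by (intro measurable_norm_Rd measurable_diff_Rd prlmc_step_measurable measurable_const)
    show "AE z in noise. norm (dist_Rd x (step x z)) \<le> norm (1 + 2 * sq d x + 2 * sq d (step x z))"
    proof (rule AE_I2)
      fix z
      have "dist_Rd x (step x z) \<le> 1 + 2 * sq d x + 2 * sq d (step x z)"
        using norm_Rd_le[of d "diff_Rd d x (step x z)"] sq_diff_le[of d x "step x z"] by linarith
      then show "norm (dist_Rd x (step x z)) \<le> norm (1 + 2 * sq d x + 2 * sq d (step x z))"
        by simp
    qed
  qed
qed

definition smoothing_constant :: real where
  "smoothing_constant = real d * sqrt (1 + 2 * \<eta> * (real K * (L + 4 * \<eta> * L\<^sup>2)) +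
    \<eta>\<^sup>2 * ((2 + 12 * (real K)\<^sup>2) * L\<^sup>2)) / sqrt (2 * \<eta>)"

lemma smoothing_constant_nonneg: "0 \<le> smoothing_constant"
  using \<eta> L by (simp add: smoothing_constant_def)

text \<open>
  Conditionally on the coins and the midpoints, the new state is a Gaussian vector with centre
  \<open>drift\<close>.
\<close>

lemma measure_kernel:
  fixes x A
  defines "u \<equiv> \<lambda>r. measure (std_gauss d)
    {\<xi> \<in> space (Rd d). (\<lambda>j\<in>{..<d}. drift K \<eta> x (fst r) (snd r) j + sqrt (2 * \<eta>) * \<xi> j) \<in> A}"
  assumes x: "x \<in> space (Rd d)" and A: "A \<in> sets (Rd d)"
  shows "measure (prlmc_kernel d K U \<eta> x) A = (\<integral>r. u r \<partial>(coins K \<Otimes>\<^sub>M gausses d K))"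
    and "integrable (coins K \<Otimes>\<^sub>M gausses d K) u"
proof -
  let ?R = "coins K \<Otimes>\<^sub>M gausses d K"
  interpret R: prob_space ?R by (intro prob_space_pair prob_space_coins prob_space_gausses)
  interpret G: prob_space "std_gauss d" by (rule prob_space_std_gauss)
  let ?I = "\<lambda>r \<xi>. indicator A (step x (fst r, \<xi>, snd r)) :: ennreal"
  have eq: "(\<integral>\<^sup>+\<xi>. ?I r \<xi> \<partial>std_gauss d) = ennreal (u r)" for r
  proof -
    let ?E = "{\<xi> \<in> space (Rd d). (\<lambda>j\<in>{..<d}. drift K \<eta> x (fst r) (snd r) j + sqrt (2 * \<eta>) * \<xi> j) \<in> A}"
    have "(\<lambda>\<xi>. \<lambda>j\<in>{..<d}. drift K \<eta> x (fst r) (snd r) j + sqrt (2 * \<eta>) * \<xi> j) \<in> Rd d \<rightarrow>\<^sub>M Rd d"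
      by (intro measurable_Rd_restrict borel_measurable_add borel_measurable_times borel_measurable_const
          measurable_Rd_component[of _ _ d]) auto
    from measurable_sets[OF this A] have E: "?E \<in> sets (std_gauss d)"
      by (simp add: vimage_def Int_def conj_commute)
    have "(\<integral>\<^sup>+\<xi>. ?I r \<xi> \<partial>std_gauss d) = (\<integral>\<^sup>+\<xi>. indicator ?E \<xi> \<partial>std_gauss d)"
      by (intro nn_integral_cong) (simp add: prlmc_step_eq indicator_def)
    also have "\<dots> = emeasure (std_gauss d) ?E"
      by (rule nn_integral_indicator[OF E])
    finally show ?thesis by (simp only: u_def G.emeasure_eq_measure)
  qed
  have "(\<lambda>p. (fst (fst p), snd p, snd (fst p))) \<in> ?R \<Otimes>\<^sub>M std_gauss d \<rightarrow>\<^sub>M noise"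
    unfolding prlmc_noise_def by measurable
  from measurable_compose[OF measurable_compose[OF this prlmc_step_measurable[OF x]] borel_measurable_indicator[OF A]]
  have "(\<lambda>r. \<integral>\<^sup>+\<xi>. ?I r \<xi> \<partial>std_gauss d) \<in> borel_measurable ?R"
    by (intro G.borel_measurable_nn_integral) (simp add: split_beta')
  then have "(\<lambda>r. ennreal (u r)) \<in> borel_measurable ?R"
    unfolding eq .
  then have "(\<lambda>r. enn2real (ennreal (u r))) \<in> borel_measurable ?R"
    by (rule measurable_compose) simp
  then have u: "u \<in> borel_measurable ?R"
    by (simp add: u_def)
  show int: "integrable ?R u"
    by (rule R.integrable_const_bound[of _ 1]) (use u in \<open>auto simp: u_def\<close>)
  have "emeasure (prlmc_kernel d K U \<eta> x) A = (\<integral>\<^sup>+z. indicator A (step x z) \<partial>noise)"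
    using nn_integral_distr[OF prlmc_step_measurable[OF x], of "indicator A"] A
    by (simp add: prlmc_kernel_def)
  also have "\<dots> = (\<integral>\<^sup>+r. \<integral>\<^sup>+\<xi>. ?I r \<xi> \<partial>std_gauss d \<partial>?R)"
    by (rule nn_integral_prlmc_noise)
       (rule measurable_compose[OF prlmc_step_measurable[OF x] borel_measurable_indicator[OF A]])
  also have "\<dots> = ennreal (\<integral>r. u r \<partial>?R)"
    unfolding eq by (intro nn_integral_eq_integral int) (simp add: u_def)
  finally show "measure (prlmc_kernel d K U \<eta> x) A = (\<integral>r. u r \<partial>?R)"
    by (simp add: measure_def u_def integral_nonneg_AE)
qed

text \<open>
  Conditionally on the coins and the midpoints, two steps are Gaussian vectors with different
  centres, whose distance is bounded pathwise by a multiple of the distance of the starting points.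
\<close>

lemma kernel_smoothing:
  assumes x: "x \<in> space (Rd d)" and y: "y \<in> space (Rd d)" and A: "A \<in> sets (Rd d)"
  shows "\<bar>measure (prlmc_kernel d K U \<eta> x) A - measure (prlmc_kernel d K U \<eta> y) A\<bar>
    \<le> smoothing_constant * dist_Rd x y"
proof -
  let ?R = "coins K \<Otimes>\<^sub>M gausses d K"
  interpret R: prob_space ?R by (intro prob_space_pair prob_space_coins prob_space_gausses)
  define u where "u x r = measure (std_gauss d)
    {\<xi> \<in> space (Rd d). (\<lambda>j\<in>{..<d}. drift K \<eta> x (fst r) (snd r) j + sqrt (2 * \<eta>) * \<xi> j) \<in> A}" for x r
  let ?c = "1 + 2 * \<eta> * (real K * (L + 4 * \<eta> * L\<^sup>2)) + \<eta>\<^sup>2 * ((2 + 12 * (real K)\<^sup>2) * L\<^sup>2)"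
  have int: "integrable ?R (u z)" and rep: "measure (prlmc_kernel d K U \<eta> z) A = (\<integral>r. u z r \<partial>?R)"
    if "z \<in> space (Rd d)" for z
    unfolding u_def using measure_kernel[OF that A] by auto
  have le: "\<bar>u x r - u y r\<bar> \<le> smoothing_constant * dist_Rd x y" for r
  proof -
    let ?a = "drift K \<eta> x (fst r) (snd r)" and ?b = "drift K \<eta> y (fst r) (snd r)"
    have "\<bar>u x r - u y r\<bar> \<le> (\<Sum>j<d. \<bar>?a j - ?b j\<bar>) / sqrt (2 * \<eta>)"
      unfolding u_def using \<eta> by (intro std_gauss_shift A) simp
    also have "\<dots> \<le> (\<Sum>j<d. sqrt ?c * dist_Rd x y) / sqrt (2 * \<eta>)"
    proof (intro divide_right_mono sum_mono)
      fix j assume "j \<in> {..<d}"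
      then have "\<bar>?a j - ?b j\<bar> \<le> dist_Rd ?a ?b"
        using abs_coordinate_le[of j d "diff_Rd d ?a ?b"] by simp
      also have "\<dots> \<le> sqrt (?c * sq d (diff_Rd d x y))"
        unfolding norm_Rd_def
        using drift_difference_bound[OF \<eta> \<eta>L x y, where K = K and h = "fst r" and \<zeta> = "snd r"]
        by (intro real_sqrt_le_mono) (rule order_trans[OF _ contraction_bound_le],
          auto intro: grad_strongly_monotone grad_inner_le x y simp: hits_le)
      also have "\<dots> = sqrt ?c * dist_Rd x y"
        by (simp only: real_sqrt_mult norm_Rd_def)
      finally show "\<bar>?a j - ?b j\<bar> \<le> sqrt ?c * dist_Rd x y" .
    qed (use \<eta> in simp)
    also have "\<dots> = smoothing_constant * dist_Rd x y"
      by (simp add: smoothing_constant_def)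
    finally show ?thesis .
  qed
  have "\<bar>measure (prlmc_kernel d K U \<eta> x) A - measure (prlmc_kernel d K U \<eta> y) A\<bar>
      = \<bar>\<integral>r. u x r - u y r \<partial>?R\<bar>"
    by (simp add: rep int x y)
  also have "\<dots> \<le> (\<integral>r. smoothing_constant * dist_Rd x y \<partial>?R)"
    by (intro integral_abs_bound[THEN order_trans] integral_mono integrable_abs
        Bochner_Integration.integrable_diff int x y R.integrable_const le)
  finally show ?thesis by (simp add: R.prob_space)
qed

sublocale chain: contractive_random_iteration noise "Rd d" step dist_Rd smoothing_constant \<rho>
  rewrites "random_iteration.kernel noise (Rd d) step = prlmc_kernel d K U \<eta>"
proof -
  have ri: "random_iteration noise (Rd d) step"
    by (intro random_iteration.intro random_iteration_axioms.intro prob_space_prlmc_noise measurable_prlmc_step)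
  have kernel: "random_iteration.kernel noise (Rd d) step = prlmc_kernel d K U \<eta>"
    by (simp add: fun_eq_iff random_iteration.kernel_def[OF ri] prlmc_kernel_def)
  show "contractive_random_iteration noise (Rd d) step dist_Rd smoothing_constant \<rho>"
  proof (intro contractive_random_iteration.intro ri contractive_random_iteration_axioms.intro)
    show "space (Rd d) \<noteq> {}" using zero_in_space by blast
    show "0 \<le> \<rho>" "\<rho> < 1" using \<rho> by linarith+
  qed (rule smoothing_constant_nonneg kernel_smoothing[folded kernel] integrable_dist_step step_contraction
      integrable_dist_displacement; assumption)+
  show "random_iteration.kernel noise (Rd d) step = prlmc_kernel d K U \<eta>"
    by (rule kernel)
qed

end

section \<open>The stationary distribution of the chain\<close>

lemma dTV_bounds:
  assumes "\<And>A. A \<in> sets (Rd d) \<Longrightarrow> \<bar>measure \<mu> A - measure \<nu> A\<bar> \<le> c"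
  shows "0 \<le> d_TV d \<mu> \<nu>" "d_TV d \<mu> \<nu> \<le> c"
proof -
  have "bdd_above ((\<lambda>A. \<bar>measure \<mu> A - measure \<nu> A\<bar>) ` sets (Rd d))"
    using assms by (auto simp: bdd_above_def)
  then have "\<bar>measure \<mu> {} - measure \<nu> {}\<bar> \<le> d_TV d \<mu> \<nu>"
    unfolding d_TV_def by (intro cSUP_upper) auto
  then show "0 \<le> d_TV d \<mu> \<nu>" by simp
  show "d_TV d \<mu> \<nu> \<le> c"
    unfolding d_TV_def using assms by (intro cSUP_least) auto
qed

lemma prlmc_chain_eq_orbit: "prlmc_chain d K U \<eta> x \<omega> n = orbit (prlmc_step d K U \<eta>) x \<omega> n"
  by (induction n) simp_all

text \<open>
  The choice of \<open>\<delta>\<close> lies strictly between \<open>1\<close> and \<open>1 / r\<close>.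
\<close>

lemma exponential_decay:
  fixes t :: "nat \<Rightarrow> real"
  assumes r: "0 < r" "r < 1" and t: "\<And>n. 0 \<le> t (Suc n)" "\<And>n. t (Suc n) \<le> c * r ^ n"
  defines "\<delta> \<equiv> 2 / (1 + r)"
  shows "summable (\<lambda>n. \<delta> ^ Suc n * t (Suc n))" and "t \<in> o(\<lambda>n. \<delta> powr (- real n))"
proof -
  have \<delta>: "1 < \<delta>" "0 \<le> \<delta> * r" "\<delta> * r < 1"
    using r by (auto simp: \<delta>_def field_simps)
  show sum: "summable (\<lambda>n. \<delta> ^ Suc n * t (Suc n))"
  proof (rule summable_comparison_test')
    show "summable (\<lambda>n. \<delta> * c * (\<delta> * r) ^ n)"
      using \<delta> by (intro summable_mult summable_geometric) simp
    fix n
    have "\<delta> ^ Suc n * t (Suc n) \<le> \<delta> ^ Suc n * (c * r ^ n)"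
      using t(2) \<delta> by (intro mult_left_mono) auto
    also have "\<dots> = \<delta> * c * (\<delta> * r) ^ n"
      by (simp add: power_mult_distrib)
    finally show "norm (\<delta> ^ Suc n * t (Suc n)) \<le> \<delta> * c * (\<delta> * r) ^ n"
      using t(1)[of n] \<delta>(1) by (simp only: real_norm_def abs_of_nonneg mult_nonneg_nonneg zero_le_power)
  qed
  have "(\<lambda>n. \<delta> ^ n * t n) \<longlonglongrightarrow> 0"
    using summable_LIMSEQ_zero[OF sum] by (rule LIMSEQ_imp_Suc)
  moreover have "t n / \<delta> powr (- real n) = \<delta> ^ n * t n" for n
    using \<delta>(1) by (simp add: powr_minus powr_realpow divide_inverse)
  ultimately show "t \<in> o(\<lambda>n. \<delta> powr (- real n))"
    using \<delta>(1) by (intro smalloI_tendsto) auto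
qed

context prlmc
begin

lemma prlmc_law_eq: "prlmc_law d K U \<eta> x n = chain.law x n"
  by (simp add: prlmc_law_def chain.law_def prlmc_chain_eq_orbit)

lemma prlmc_stationary_eq: "prlmc_stationary d K U \<eta> \<nu> \<longleftrightarrow> chain.stationary \<nu>"
  by (simp add: prlmc_stationary_def chain.stationary_def)

theorem prlmc_ergodicity:
  obtains \<pi> where "prlmc_stationary d K U \<eta> \<pi>"
    and "\<And>\<nu>. prlmc_stationary d K U \<eta> \<nu> \<Longrightarrow> \<nu> = \<pi>"
    and "(\<integral>\<^sup>+x. ennreal (sq d x) \<partial>\<pi>) \<le> ennreal (2 * real d / m)"
    and "\<And>x n A. x \<in> space (Rd d) \<Longrightarrow> A \<in> sets (Rd d) \<Longrightarrow>
      \<bar>measure (prlmc_law d K U \<eta> x (Suc n)) A - measure \<pi> A\<bar> \<le> chain.rate x * \<rho> ^ n"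
proof (rule chain.exponential_ergodicity)
  fix \<pi> assume stat: "chain.stationary \<pi>" and unique: "\<And>\<nu>. chain.stationary \<nu> \<Longrightarrow> \<nu> = \<pi>"
    and rate: "\<And>x n A. x \<in> space (Rd d) \<Longrightarrow> A \<in> sets (Rd d) \<Longrightarrow>
      \<bar>measure (chain.law x (Suc n)) A - measure \<pi> A\<bar> \<le> chain.rate x * \<rho> ^ n"
    and drift: "\<And>V a b x. V \<in> borel_measurable (Rd d) \<Longrightarrow> 0 \<le> a \<Longrightarrow> a < 1 \<Longrightarrow> 0 \<le> b \<Longrightarrow>
      (\<And>x. x \<in> space (Rd d) \<Longrightarrow> (\<integral>\<^sup>+z. V (step x z) \<partial>noise) \<le> ennreal a * V x + ennreal b) \<Longrightarrow>
      x \<in> space (Rd d) \<Longrightarrow> V x < \<infinity> \<Longrightarrow> (\<integral>\<^sup>+y. V y \<partial>\<pi>) \<le> ennreal (b / (1 - a))"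
  have "(\<integral>\<^sup>+x. ennreal (sq d x) \<partial>\<pi>) \<le> ennreal (11 / 5 * \<eta> * real d / (1 - (1 - 5 / 4 * (\<eta> * m))))"
  proof (rule drift)
    show "(\<lambda>x. ennreal (sq d x)) \<in> borel_measurable (Rd d)"
      by (intro measurable_compose[OF measurable_inner_Rd measurable_ennreal]) simp_all
    show "0 \<le> 1 - 5 / 4 * (\<eta> * m)" "1 - 5 / 4 * (\<eta> * m) < 1"
      using \<eta>m by linarith+
    show "0 \<le> 11 / 5 * \<eta> * real d"
      using \<eta> by simp
    show "zero_vec d \<in> space (Rd d)" by simp
    show "ennreal (sq d (zero_vec d)) < \<infinity>" by simp
  qed (rule second_moment_step)
  also have "\<dots> \<le> ennreal (2 * real d / m)"
  proof (rule ennreal_leI)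
    have "11 / 5 * \<eta> * real d / (1 - (1 - 5 / 4 * (\<eta> * m))) = 44 / 25 * (real d / m)"
      using \<eta> m by (simp add: field_simps)
    also have "\<dots> \<le> 2 * (real d / m)"
      using m by (intro mult_right_mono) auto
    finally show "11 / 5 * \<eta> * real d / (1 - (1 - 5 / 4 * (\<eta> * m))) \<le> 2 * real d / m" by simp
  qed
  finally have moment: "(\<integral>\<^sup>+x. ennreal (sq d x) \<partial>\<pi>) \<le> ennreal (2 * real d / m)" .
  show thesis
  proof (rule that[of \<pi>])
    show "prlmc_stationary d K U \<eta> \<pi>"
      using stat by (simp only: prlmc_stationary_eq)
    show "\<nu> = \<pi>" if "prlmc_stationary d K U \<eta> \<nu>" for \<nu>
      using that by (intro unique) (simp only: prlmc_stationary_eq)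
    show "\<bar>measure (prlmc_law d K U \<eta> x (Suc n)) A - measure \<pi> A\<bar> \<le> chain.rate x * \<rho> ^ n"
      if "x \<in> space (Rd d)" "A \<in> sets (Rd d)" for x n A
      unfolding prlmc_law_eq using that by (rule rate)
  qed (rule moment)
qed

theorem prlmc_stationary_and_decay:
  "\<exists>\<pi>. prlmc_stationary d K U \<eta> \<pi> \<and>
       (\<forall>\<nu>. prlmc_stationary d K U \<eta> \<nu> \<longrightarrow> \<nu> = \<pi>) \<and>
       integrable \<pi> (\<lambda>x. (norm_Rd d x)\<^sup>2) \<and>
       (\<integral>x. (norm_Rd d x)\<^sup>2 \<partial>\<pi>) \<le> 2 * real d / m \<and>
       (\<exists>\<delta>>1. \<forall>x\<in>space (Rd d).
          summable (\<lambda>n. \<delta> ^ Suc n * d_TV d (prlmc_law d K U \<eta> x (Suc n)) \<pi>) \<and>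
          (\<lambda>n. d_TV d (prlmc_law d K U \<eta> x n) \<pi>) \<in> o(\<lambda>n. \<delta> powr (- real n)))"
proof -
  obtain \<pi> where stat: "prlmc_stationary d K U \<eta> \<pi>"
    and unique: "\<And>\<nu>. prlmc_stationary d K U \<eta> \<nu> \<Longrightarrow> \<nu> = \<pi>"
    and moment: "(\<integral>\<^sup>+x. ennreal (sq d x) \<partial>\<pi>) \<le> ennreal (2 * real d / m)"
    and rate: "\<And>x n A. x \<in> space (Rd d) \<Longrightarrow> A \<in> sets (Rd d) \<Longrightarrow>
      \<bar>measure (prlmc_law d K U \<eta> x (Suc n)) A - measure \<pi> A\<bar> \<le> chain.rate x * \<rho> ^ n"
    using prlmc_ergodicity by blast
  have sets: "sets \<pi> = sets (Rd d)" using stat by (simp add: prlmc_stationary_def)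
  have meas: "(\<lambda>x. sq d x) \<in> borel_measurable \<pi>"
    unfolding measurable_cong_sets[OF sets refl] by (intro measurable_inner_Rd) simp_all
  have int: "integrable \<pi> (\<lambda>x. sq d x)"
    by (rule integrableI_nonneg[OF meas]) (use moment in \<open>auto intro: le_less_trans\<close>)
  have "(\<integral>\<^sup>+x. ennreal (sq d x) \<partial>\<pi>) = ennreal (\<integral>x. sq d x \<partial>\<pi>)"
    using int by (intro nn_integral_eq_integral) auto
  with moment have "ennreal (\<integral>x. sq d x \<partial>\<pi>) \<le> ennreal (2 * real d / m)"
    by (simp only:)
  then have bound: "(\<integral>x. sq d x \<partial>\<pi>) \<le> 2 * real d / m"
    by (subst (asm) ennreal_le_iff) (use m in auto)
  have \<delta>: "1 < 2 / (1 + \<rho>)"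
    using \<rho> by (subst less_divide_eq_1_pos) linarith+
  have decay: "summable (\<lambda>n. (2 / (1 + \<rho>)) ^ Suc n * d_TV d (prlmc_law d K U \<eta> x (Suc n)) \<pi>) \<and>
      (\<lambda>n. d_TV d (prlmc_law d K U \<eta> x n) \<pi>) \<in> o(\<lambda>n. (2 / (1 + \<rho>)) powr (- real n))"
    if x: "x \<in> space (Rd d)" for x
  proof -
    have "0 \<le> d_TV d (prlmc_law d K U \<eta> x (Suc n)) \<pi>"
      and "d_TV d (prlmc_law d K U \<eta> x (Suc n)) \<pi> \<le> chain.rate x * \<rho> ^ n" for n
      by (rule dTV_bounds[of d], erule rate[OF x])+
    from exponential_decay[OF \<rho> this] show ?thesis by (rule conjI)
  qed
  show ?thesis
    unfolding norm_Rd_square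
  proof (rule exI[of _ \<pi>], intro conjI allI impI)
    show "\<exists>\<delta>>1. \<forall>x\<in>space (Rd d).
        summable (\<lambda>n. \<delta> ^ Suc n * d_TV d (prlmc_law d K U \<eta> x (Suc n)) \<pi>) \<and>
        (\<lambda>n. d_TV d (prlmc_law d K U \<eta> x n) \<pi>) \<in> o(\<lambda>n. \<delta> powr (- real n))"
    proof (rule exI[of _ "2 / (1 + \<rho>)"], rule conjI[OF \<delta>], rule ballI)
    qed (rule decay)
  qed (fact stat int bound | erule unique)+
qed

end

theorem theorem2p3:
  fixes m L :: real
  assumes "0 < m" and "m \<le> L"
  shows "\<exists>\<eta>0. 0 < \<eta>0 \<and> \<eta>0 < 1 \<and>
    (\<forall>(d :: nat) (U :: (nat \<Rightarrow> real) \<Rightarrow> real) (K :: nat).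
       C1_on_Rd d U \<longrightarrow>
       grad d U (zero_vec d) = zero_vec d \<longrightarrow>
       (\<forall>x\<in>space (Rd d). \<forall>y\<in>space (Rd d).
          m / 2 * (norm_Rd d (diff_Rd d x y))\<^sup>2
            \<le> U y - U x - inner_Rd d (grad d U x) (diff_Rd d y x) \<and>
          U y - U x - inner_Rd d (grad d U x) (diff_Rd d y x)
            \<le> L / 2 * (norm_Rd d (diff_Rd d x y))\<^sup>2) \<longrightarrow>
       1 \<le> K \<longrightarrow>
       (\<forall>\<eta>. 0 < \<eta> \<and> \<eta> < \<eta>0 \<longrightarrow>
         (\<exists>\<pi>. prlmc_stationary d K U \<eta> \<pi> \<and>
              (\<forall>\<nu>. prlmc_stationary d K U \<eta> \<nu> \<longrightarrow> \<nu> = \<pi>) \<and>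
              integrable \<pi> (\<lambda>x. (norm_Rd d x)\<^sup>2) \<and>
              (\<integral>x. (norm_Rd d x)\<^sup>2 \<partial>\<pi>)
                \<le> real d / m * (2 + 4 * \<eta>\<^sup>2 * L\<^sup>2 * (2 - 1 / real K) + L\<^sup>2 * (1 - 1 / real K)) \<and>
              (\<exists>\<delta>>1. \<forall>x\<in>space (Rd d).
                 summable (\<lambda>n. \<delta> ^ Suc n * d_TV d (prlmc_law d K U \<eta> x (Suc n)) \<pi>) \<and>
                 (\<lambda>n. d_TV d (prlmc_law d K U \<eta> x n) \<pi>) \<in> o(\<lambda>n. \<delta> powr (- real n))))))"
proof (rule exI[of _ "min (1 / 2) (m / (100 * L\<^sup>2))"], intro conjI allI impI)
  have L: "0 < L" using assms by simp
  show "0 < min (1 / 2) (m / (100 * L\<^sup>2))" using assms L by simp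
  show "min (1 / 2) (m / (100 * L\<^sup>2)) < 1" by simp
  fix d :: nat and U :: "(nat \<Rightarrow> real) \<Rightarrow> real" and K :: nat and \<eta> :: real
  assume U: "C1_on_Rd d U" "grad d U (zero_vec d) = zero_vec d"
    and convex: "\<forall>x\<in>space (Rd d). \<forall>y\<in>space (Rd d).
          m / 2 * (norm_Rd d (diff_Rd d x y))\<^sup>2
            \<le> U y - U x - inner_Rd d (grad d U x) (diff_Rd d y x) \<and>
          U y - U x - inner_Rd d (grad d U x) (diff_Rd d y x)
            \<le> L / 2 * (norm_Rd d (diff_Rd d x y))\<^sup>2"
    and K: "1 \<le> K" and \<eta>: "0 < \<eta> \<and> \<eta> < min (1 / 2) (m / (100 * L\<^sup>2))"
  have "\<eta> * (100 * L\<^sup>2) \<le> m"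
    using \<eta> L by (simp add: pos_less_divide_eq)
  then interpret prlmc d U m L K \<eta>
    using assms U convex K \<eta> by unfold_locales (simp_all only: norm_Rd_square)
  let ?bound = "real d / m * (2 + 4 * \<eta>\<^sup>2 * L\<^sup>2 * (2 - 1 / real K) + L\<^sup>2 * (1 - 1 / real K))"
  have "1 / real K \<le> 1" using K by simp
  then have "2 \<le> 2 + 4 * \<eta>\<^sup>2 * L\<^sup>2 * (2 - 1 / real K) + L\<^sup>2 * (1 - 1 / real K)"
    by (simp add: add_nonneg_nonneg)
  from mult_left_mono[OF this, of "real d / m"]
  have "2 * real d / m \<le> ?bound" using assms by (simp add: mult.commute)
  with prlmc_stationary_and_decay show "\<exists>\<pi>. prlmc_stationary d K U \<eta> \<pi> \<and>
              (\<forall>\<nu>. prlmc_stationary d K U \<eta> \<nu> \<longrightarrow> \<nu> = \<pi>) \<and>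
              integrable \<pi> (\<lambda>x. (norm_Rd d x)\<^sup>2) \<and>
              (\<integral>x. (norm_Rd d x)\<^sup>2 \<partial>\<pi>) \<le> ?bound \<and>
              (\<exists>\<delta>>1. \<forall>x\<in>space (Rd d).
                 summable (\<lambda>n. \<delta> ^ Suc n * d_TV d (prlmc_law d K U \<eta> x (Suc n)) \<pi>) \<and>
                 (\<lambda>n. d_TV d (prlmc_law d K U \<eta> x n) \<pi>) \<in> o(\<lambda>n. \<delta> powr (- real n)))"
    by (meson order_trans)
qed

end
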